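(* Let $K \subset \mathbb{R}^n$ be a convex body with the origin in its interior, let $L \subset \mathbb{R}^n$ be a convex body, and suppose that $L$ is in saddle-John position inside $K$. Then there exist contact pairs $(x_1, y_1), \ldots, (x_m, y_m)$ of $K, L$ and numbers $c_1,\ldots,c_m > 0$ such that: (1) $\sum_{i=1}^m c_i y_i = 0$; (2) $\sum_{i=1}^m c_i\,(x_i \otimes y_i) = I_n$.
   Context: A convex body in $\mathbb{R}^n$ is a compact convex set with nonempty interior. $\mathcal{P}^n$ is the set of symmetric positive-definite real $n\times n$ matrices and $O_n$ the orthogonal group. A positive image of $L$ in $K$ is a set $PL+z \subset K$ with $P \in \mathcal{P}^n$, $z \in \mathbb{R}^n$. There is a unique positive image of $L$ in $K$ of maximal volume, called the positive John image of $L$ in $K$, and the pair $(P,z)$ realizing it is unique. For $U \in O_n$, let $(P^*(U), z^*(U)) \in \mathcal{P}^n\times\mathbb{R}^n$ be the unique pair such that $P^*(U)UL + z^*(U)$ is the positive John image of $UL$ in $K$. A saddle-John image of $L$ inside $K$ is a set of the form $P^*(U^* )U^*L + z^*(U^* )$ where $U^* \in \operatorname{argmin}_{U \in O_n} \det P^*(U)$. $L$ is in saddle-John position inside $K$ if $L$ is itself a saddle-John image of $L$ inside $K$. For a set $S$, $S^\circ = \{y : \langle x,y\rangle \le 1 \ \forall x\in S\}$ is its polar. A contact pair of $K, L$ is a pair $(x,y)$ with $x \in \partial L\cap\partial K$, $y \in \partial L^\circ\cap\partial K^\circ$ and $\langle x,y\rangle = 1$. $x\otimes y$ denotes the matrix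 $xy^T$, and $I_n$ is the identity matrix. *)

theory Defs
  imports "HOL-Analysis.Analysis"
begin

definition convex_body :: "(real ^ 'n) set \<Rightarrow> bool" where
  "convex_body K \<longleftrightarrow> compact K \<and> convex K \<and> interior K \<noteq> {}"

definition pos_def :: "real ^ 'n ^ 'n \<Rightarrow> bool" where
  "pos_def P \<longleftrightarrow> transpose P = P \<and> (\<forall>x. x \<noteq> 0 \<longrightarrow> 0 < x \<bullet> (P *v x))"

definition affine_img :: "real ^ 'n ^ 'n \<Rightarrow> real ^ 'n \<Rightarrow> (real ^ 'n) set \<Rightarrow> (real ^ 'n) set" where
  "affine_img A z L = (\<lambda>x. A *v x + z) ` L"

definition positive_image :: "(real ^ 'n) set \<Rightarrow> (real ^ 'n) set \<Rightarrow> (real ^ 'n) set \<Rightarrow> bool" where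
  "positive_image K L S \<longleftrightarrow> (\<exists>P z. pos_def P \<and> S = affine_img P z L) \<and> S \<subseteq> K"

definition positive_john_image :: "(real ^ 'n) set \<Rightarrow> (real ^ 'n) set \<Rightarrow> (real ^ 'n) set \<Rightarrow> bool" where
  "positive_john_image K L S \<longleftrightarrow> positive_image K L S \<and>
     (\<forall>S'. positive_image K L S' \<longrightarrow> measure lebesgue S' \<le> measure lebesgue S)"

text \<open>The pair \<open>(P\<^sup>*(U), z\<^sup>*(U))\<close>. When \<open>K\<close> and \<open>L\<close> are convex bodies and \<open>U\<close> is orthogonal, a pair
  with this property exists and is unique, so the description is proper.\<close>

definition john_pair ::
  "(real ^ 'n) set \<Rightarrow> (real ^ 'n) set \<Rightarrow> real ^ 'n ^ 'n \<Rightarrow> (real ^ 'n ^ 'n) \<times> (real ^ 'n)" where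
  "john_pair K L U = (THE (P, z). pos_def P \<and>
     positive_john_image K ((*v) U ` L) (affine_img P z ((*v) U ` L)))"

definition Pstar :: "(real ^ 'n) set \<Rightarrow> (real ^ 'n) set \<Rightarrow> real ^ 'n ^ 'n \<Rightarrow> real ^ 'n ^ 'n" where
  "Pstar K L U = fst (john_pair K L U)"

definition zstar :: "(real ^ 'n) set \<Rightarrow> (real ^ 'n) set \<Rightarrow> real ^ 'n ^ 'n \<Rightarrow> real ^ 'n" where
  "zstar K L U = snd (john_pair K L U)"

definition saddle_john_image :: "(real ^ 'n) set \<Rightarrow> (real ^ 'n) set \<Rightarrow> (real ^ 'n) set \<Rightarrow> bool" where
  "saddle_john_image K L S \<longleftrightarrow>
     (\<exists>U. is_arg_min (\<lambda>V. det (Pstar K L V)) orthogonal_matrix U \<and>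
          S = affine_img (Pstar K L U) (zstar K L U) ((*v) U ` L))"

definition saddle_john_position :: "(real ^ 'n) set \<Rightarrow> (real ^ 'n) set \<Rightarrow> bool" where
  "saddle_john_position K L \<longleftrightarrow> saddle_john_image K L L"

definition polar :: "(real ^ 'n) set \<Rightarrow> (real ^ 'n) set" where
  "polar S = {y. \<forall>x\<in>S. x \<bullet> y \<le> 1}"

definition contact_pair ::
  "(real ^ 'n) set \<Rightarrow> (real ^ 'n) set \<Rightarrow> real ^ 'n \<Rightarrow> real ^ 'n \<Rightarrow> bool" where
  "contact_pair K L x y \<longleftrightarrow>
     x \<in> frontier L \<inter> frontier K \<and> y \<in> frontier (polar L) \<inter> frontier (polar K) \<and> x \<bullet> y = 1"

definition outer_prod :: "real ^ 'n \<Rightarrow> real ^ 'n \<Rightarrow> real ^ 'n ^ 'n" (infixl \<open>\<otimes>\<^sub>o\<close> 75) where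
  "x \<otimes>\<^sub>o y = (\<chi> i j. x $ i * y $ j)"

end

theory Submission
  imports Defs
begin

text \<open>
  Write \<open>L = P0 U L + z0\<close> with \<open>U\<close> a minimizer. If no decomposition of the identity exists, a
  separating hyperplane gives a matrix \<open>B\<close> of positive trace and a vector \<open>b\<close> such that the velocity
  field \<open>x \<mapsto> B x + b\<close> points strictly into \<open>K\<close> at every contact pair. Since \<open>P0\<close> is positive
  definite, the Lyapunov equation \<open>P0 S + S P0 = B P0 - P0 B\<^sup>T\<close> has a skew solution \<open>S\<close>, so that
  \<open>B P0 = M + P0 S\<close> with \<open>M\<close> symmetric. Rotate by orthogonal matrices \<open>V = I - t S + o(t)\<close>. By
  minimality of \<open>U\<close>, the John pair \<open>(P, z)\<close> of \<open>V U L\<close> has \<open>det P \<ge> det P0\<close>, and \<open>P \<rightarrow> P0\<close> by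
  compactness and uniqueness. The average of the two affine images of \<open>U L\<close> with linear parts
  \<open>(I + t B) P0\<close> and \<open>P V\<close> has, up to \<open>o(t)\<close>, the symmetric linear part \<open>(P + P0 + t M) / 2\<close>, whose
  determinant exceeds \<open>det P0\<close> by strict log-concavity of the determinant. By maximality of \<open>P0\<close>
  this image leaves \<open>K\<close>, and the points where it does converge to a contact pair at which
  \<open>B x + b\<close> does not point strictly inwards.
\<close>

section \<open>Matrix calculus\<close>

lemma bounded_bilinear_matrix_vector:
  "bounded_bilinear (\<lambda>(A :: real^'n^'m) x. A *v x)"
  unfolding bilinear_conv_bounded_bilinear [symmetric] bilinear_def
  by (auto intro!: linearI simp: algebra_simps scaleR_matrix_vector_assoc)

lemma matrix_add_rdistrib: "((B + C) ** A) = (B ** A) + (C ** (A :: real^'k^'n))"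
  by (vector matrix_matrix_mult_def sum.distrib[symmetric] field_simps)

lemma matrix_diff_ldistrib: "A ** (B - C) = A ** B - A ** (C :: real^'k^'n)"
  by (simp add: matrix_matrix_mult_def vec_eq_iff algebra_simps sum_subtractf)

lemma matrix_diff_rdistrib: "(B - C) ** A = B ** A - C ** (A :: real^'k^'n)"
  by (simp add: matrix_matrix_mult_def vec_eq_iff algebra_simps sum_subtractf)

lemma bounded_bilinear_matrix_matrix:
  "bounded_bilinear (\<lambda>(A :: real^'n^'m) (B :: real^'k^'n). A ** B)"
  unfolding bilinear_conv_bounded_bilinear [symmetric] bilinear_def
  by (auto intro!: linearI simp: matrix_add_ldistrib matrix_add_rdistrib
      scalar_matrix_assoc [symmetric] matrix_scalar_ac)

lemmas tendsto_matrix_vector [tendsto_intros] =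
  bounded_bilinear.tendsto [OF bounded_bilinear_matrix_vector]
lemmas tendsto_matrix_matrix [tendsto_intros] =
  bounded_bilinear.tendsto [OF bounded_bilinear_matrix_matrix]
lemmas continuous_on_matrix_vector [continuous_intros] =
  bounded_bilinear.continuous_on [OF bounded_bilinear_matrix_vector]

lemma transpose_add: "transpose (A + B) = transpose A + transpose (B :: real^'n^'m)"
  by (simp add: transpose_def vec_eq_iff)

lemma transpose_diff: "transpose (A - B) = transpose A - transpose (B :: real^'n^'m)"
  by (simp add: transpose_def vec_eq_iff)

lemma tendsto_transpose [tendsto_intros]:
  "(f \<longlongrightarrow> (A :: real^'n^'m)) F \<Longrightarrow> ((\<lambda>t. transpose (f t)) \<longlongrightarrow> transpose A) F"
  unfolding transpose_def by (intro tendsto_intros)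

lemma tendsto_det [tendsto_intros]:
  "(f \<longlongrightarrow> (A :: real^'n^'n)) F \<Longrightarrow> ((\<lambda>t. det (f t)) \<longlongrightarrow> det A) F"
  unfolding det_def by (intro tendsto_intros)

lemma continuous_on_det [continuous_intros]:
  "continuous_on S f \<Longrightarrow> continuous_on S (\<lambda>t. det (f t :: real^'n^'n))"
  unfolding continuous_on_def by (auto intro: tendsto_det)

section \<open>Positive definite matrices\<close>

lemma dot_symmetric_matrix:
  "transpose A = A \<Longrightarrow> x \<bullet> (A *v y) = (A *v x) \<bullet> (y :: real^'n)"
  by (metis dot_lmul_matrix transpose_matrix_vector)

text \<open>An isotropic vector minimizes the form on \<open>S\<close>, so its first variation there
  vanishes. Concretely, \<open>t * (2 * b) + t * t * c\<close> is nonnegative for every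
  \<open>t\<close>, which forces \<open>b = 0\<close>.\<close>

lemma semidefinite_isotropic:
  fixes A :: "real^'n^'n"
  assumes sym: "transpose A = A" and S: "subspace S"
    and psd: "\<And>x. x \<in> S \<Longrightarrow> 0 \<le> x \<bullet> (A *v x)"
    and v: "v \<in> S" "v \<bullet> (A *v v) = 0" and w: "w \<in> S"
  shows "w \<bullet> (A *v v) = 0"
proof -
  define b where "b = w \<bullet> (A *v v)"
  define c where "c = w \<bullet> (A *v w)"
  have c: "0 \<le> c"
    using psd[OF w] by (simp add: c_def)
  have "0 \<le> t * (2 * b) + t * t * c" for t
  proof -
    have "v + t *\<^sub>R w \<in> S"
      using v w S by (simp add: subspace_add subspace_scale)
    then have "0 \<le> (v + t *\<^sub>R w) \<bullet> (A *v (v + t *\<^sub>R w))"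
      by (rule psd)
    also have "v \<bullet> (A *v w) = b"
      unfolding b_def dot_symmetric_matrix[OF sym, of v w] by (rule inner_commute)
    then have "(v + t *\<^sub>R w) \<bullet> (A *v (v + t *\<^sub>R w)) = t * (2 * b) + t * t * c"
      using v(2) by (simp add: algebra_simps b_def c_def)
    finally show ?thesis .
  qed
  \<comment> \<open>The value \<open>- b / (c + 1)\<close> replaces the minimizer
    \<open>- b / c\<close>, so that \<open>c = 0\<close> needs no separate case.\<close>
  from this[of "- b / (c + 1)"] have "0 \<le> (- b / (c + 1) * (2 * b) + (- b / (c + 1)) * (- b / (c + 1)) * c) * (c + 1)\<^sup>2"
    by simp
  also have "\<dots> = - (b\<^sup>2 * (c + 2))"
    using c by (simp add: divide_simps power2_eq_square) (simp add: algebra_simps)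
  finally have "b\<^sup>2 * (c + 2) \<le> 0" by simp
  then have "b = 0"
    using c by (simp add: mult_le_0_iff)
  then show ?thesis by (simp add: b_def)
qed

text \<open>By \<open>semidefinite_isotropic\<close>, an isotropic vector lies in the kernel. This
  recovers definiteness after passing to a compact set or a limit, where only semidefiniteness
  survives directly.\<close>

lemma pos_defI:
  fixes P :: "real^'n^'n"
  assumes "transpose P = P" "\<And>x. 0 \<le> x \<bullet> (P *v x)" "det P \<noteq> 0"
  shows "pos_def P"
  unfolding pos_def_def
proof (intro conjI allI impI)
  fix x :: "real^'n" assume "x \<noteq> 0"
  have "x \<bullet> (P *v x) \<noteq> 0"
  proof
    assume "x \<bullet> (P *v x) = 0"
    then have "w \<bullet> (P *v x) = 0" for w
      using semidefinite_isotropic[OF assms(1) subspace_UNIV, of x w] assms(2) by simp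
    then have "P *v x = P *v 0" by (metis inner_eq_zero_iff matrix_vector_mult_0_right)
    moreover have "inj ((*v) P)" using assms(3) by (simp add: inj_matrix_vector_mult invertible_det_nz)
    ultimately show False using \<open>x \<noteq> 0\<close> by (meson injD)
  qed
  then show "0 < x \<bullet> (P *v x)" using assms(2)[of x] by simp
qed (fact assms(1))

text \<open>The constant is the minimum of the form on the unit sphere; homogeneity extends the
  bound to all vectors.\<close>

lemma pos_def_coercive:
  fixes A :: "real^'n^'n"
  assumes "pos_def A"
  obtains \<mu> where "0 < \<mu>" "\<And>x. \<mu> * (norm x)\<^sup>2 \<le> x \<bullet> (A *v x)"
proof -
  have ne: "sphere (0 :: real^'n) 1 \<noteq> {}" by simp
  have "continuous_on (sphere 0 1) (\<lambda>x. x \<bullet> (A *v x))"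
    by (intro continuous_intros)
  then obtain u where u: "u \<in> sphere 0 1" "\<And>x. x \<in> sphere 0 1 \<Longrightarrow> u \<bullet> (A *v u) \<le> x \<bullet> (A *v x)"
    using continuous_attains_inf[OF compact_sphere ne] by blast
  show thesis
  proof
    show "0 < u \<bullet> (A *v u)"
      using assms u(1) by (metis mem_sphere_0 norm_zero pos_def_def zero_neq_one)
    fix x :: "real^'n"
    show "(u \<bullet> (A *v u)) * (norm x)\<^sup>2 \<le> x \<bullet> (A *v x)"
    proof (cases "x = 0")
      case False
      then have "u \<bullet> (A *v u) \<le> (x /\<^sub>R norm x) \<bullet> (A *v (x /\<^sub>R norm x))"
        by (intro u) simp
      also have "\<dots> = (x \<bullet> (A *v x)) / (norm x)\<^sup>2"
        by (simp add: matrix_vector_mult_scaleR power2_eq_square divide_simps)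
      finally show ?thesis
        using False by (simp add: field_simps)
    qed simp
  qed
qed

lemma pos_def_convex:
  assumes "pos_def A" "pos_def B" "0 < a" "0 < b"
  shows "pos_def (a *\<^sub>R A + b *\<^sub>R B)"
  using assms unfolding pos_def_def
  by (auto simp: transpose_add transpose_scalar algebra_simps scaleR_matrix_vector_assoc [symmetric]
      intro!: add_pos_pos)

lemma pos_def_perturb:
  fixes A M :: "real^'n^'n"
  assumes "pos_def A" "transpose M = M"
  shows "\<forall>\<^sub>F t in at_right 0. pos_def (A + t *\<^sub>R M)"
proof -
  obtain \<mu> where \<mu>: "0 < \<mu>" "\<And>x. \<mu> * (norm x)\<^sup>2 \<le> x \<bullet> (A *v x)"
    using pos_def_coercive assms(1) by blast
  obtain C where C: "0 < C" "\<And>x. norm (M *v x) \<le> norm x * C"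
    using bounded_linear.pos_bounded[OF matrix_vector_mul_bounded_linear[of M]] by blast
  have "\<forall>\<^sub>F t in at_right 0. t < \<mu> / C"
    using \<mu> C by (intro eventually_at_right_less order_tendstoD(2)[OF tendsto_ident_at]) simp
  then show ?thesis
    using eventually_at_right_less[of 0]
  proof eventually_elim
    case (elim t)
    have "0 < x \<bullet> ((A + t *\<^sub>R M) *v x)" if "x \<noteq> 0" for x
    proof -
      have "\<bar>x \<bullet> (M *v x)\<bar> \<le> norm x * (norm x * C)"
        by (rule order_trans[OF Cauchy_Schwarz_ineq2 mult_left_mono[OF C(2)]]) simp
      then have "- (norm x)\<^sup>2 * C \<le> x \<bullet> (M *v x)"
        by (simp add: power2_eq_square algebra_simps abs_le_iff)
      then have "t * (- (norm x)\<^sup>2 * C) \<le> t * (x \<bullet> (M *v x))"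
        using elim by (intro mult_left_mono) auto
      moreover have "t * C * (norm x)\<^sup>2 < \<mu> * (norm x)\<^sup>2"
        using elim C that by (simp add: field_simps)
      ultimately show ?thesis
        using \<mu>(2)[of x]
        by (simp add: matrix_vector_mult_add_rdistrib scaleR_matrix_vector_assoc [symmetric]
            inner_add_right algebra_simps)
    qed
    then show ?case
      using assms by (simp add: pos_def_def transpose_add transpose_scalar)
  qed
qed

section \<open>Simultaneous diagonalization and strict log-concavity of the determinant\<close>

text \<open>Induction on \<open>dim S\<close>. The maximizer \<open>v\<close> of the form of
  \<open>C\<close> on the unit sphere of \<open>A\<close> in \<open>S\<close> is a generalized
  eigenvector, so the \<open>A\<close>-orthogonal complement of \<open>v\<close> in \<open>S\<close>
  is also \<open>C\<close>-orthogonal to \<open>v\<close>, and the induction continues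
  there.\<close>

lemma simultaneous_orthogonal_basis:
  fixes A C :: "real^'n^'n"
  assumes A: "pos_def A" and C: "transpose C = C" and S: "subspace S"
  shows "\<exists>B. finite B \<and> card B = dim S \<and> span B = S \<and> (\<forall>v\<in>B. v \<bullet> (A *v v) = 1) \<and>
    (\<forall>v\<in>B. \<forall>w\<in>B. v \<noteq> w \<longrightarrow> v \<bullet> (A *v w) = 0 \<and> v \<bullet> (C *v w) = 0)"
  using S
proof (induction "dim S" arbitrary: S rule: less_induct)
  case less
  note sub = \<open>subspace S\<close>
  show ?case
  proof (cases "S = {0}")
    case True
    then show ?thesis by (intro exI[of _ "{}"]) auto
  next
    case False
    have symA: "transpose A = A" using A by (simp add: pos_def_def)
    obtain \<mu> where \<mu>: "0 < \<mu>" "\<And>x. \<mu> * (norm x)\<^sup>2 \<le> x \<bullet> (A *v x)"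
      using pos_def_coercive A by blast
    define X where "X = {x. x \<bullet> (A *v x) = 1} \<inter> S"
    have "bounded {x. x \<bullet> (A *v x) = 1}"
    proof (rule boundedI)
      fix x assume "x \<in> {x. x \<bullet> (A *v x) = 1}"
      then have "(norm x)\<^sup>2 \<le> 1 / \<mu>"
        using \<mu>(2)[of x] \<mu>(1) by (simp add: field_simps)
      then show "norm x \<le> sqrt (1 / \<mu>)"
        by (simp add: real_le_rsqrt)
    qed
    moreover have "closed {x. x \<bullet> (A *v x) = 1}"
      by (intro closed_Collect_eq continuous_intros)
    ultimately have "compact X"
      unfolding X_def using closed_subspace[OF sub]
      by (auto simp: compact_Int_closed compact_eq_bounded_closed)
    moreover have "X \<noteq> {}"
    proof -
      obtain x where x: "x \<in> S" "x \<noteq> 0"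
        using False subspace_0[OF sub] by auto
      then have p: "0 < x \<bullet> (A *v x)"
        using A by (simp add: pos_def_def)
      have "(1 / sqrt (x \<bullet> (A *v x))) *\<^sub>R x \<in> X"
        using x p sub unfolding X_def
        by (simp add: subspace_scale matrix_vector_mult_scaleR)
      then show ?thesis by blast
    qed
    moreover have "continuous_on X (\<lambda>x. x \<bullet> (C *v x))"
      by (intro continuous_intros)
    ultimately have "\<exists>v\<in>X. \<forall>x\<in>X. x \<bullet> (C *v x) \<le> v \<bullet> (C *v v)"
      by (rule continuous_attains_sup)
    then obtain v where v: "v \<in> X" and vmax: "\<And>x. x \<in> X \<Longrightarrow> x \<bullet> (C *v x) \<le> v \<bullet> (C *v v)"
      by blast
    define l where "l = v \<bullet> (C *v v)"
    have vS: "v \<in> S" and v1: "v \<bullet> (A *v v) = 1"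
      using v by (auto simp: X_def)
    \<comment> \<open>This is the Lagrange condition with multiplier \<open>l\<close>: by
      maximality, \<open>l *\<^sub>R A - C\<close> is semidefinite on \<open>S\<close>, and
      \<open>v\<close> is isotropic for it.\<close>
    have "w \<bullet> ((l *\<^sub>R A - C) *v v) = 0" if "w \<in> S" for w
    proof (rule semidefinite_isotropic[OF _ sub _ vS _ that])
      show "transpose (l *\<^sub>R A - C) = l *\<^sub>R A - C"
        using symA C by (simp add: transpose_diff transpose_scalar)
      show "v \<bullet> ((l *\<^sub>R A - C) *v v) = 0"
        using v1 by (simp add: algebra_simps scaleR_matrix_vector_assoc [symmetric] l_def)
      fix x assume "x \<in> S"
      show "0 \<le> x \<bullet> ((l *\<^sub>R A - C) *v x)"
      proof (cases "x = 0")
        case False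
        define q where "q = x \<bullet> (A *v x)"
        have q: "0 < q" using False A by (simp add: pos_def_def q_def)
        have "(1 / sqrt q) *\<^sub>R x \<in> X"
          using \<open>x \<in> S\<close> q sub unfolding X_def
          by (simp add: subspace_scale matrix_vector_mult_scaleR q_def)
        from vmax[OF this] have "(x \<bullet> (C *v x)) / q \<le> l"
          using q by (simp add: matrix_vector_mult_scaleR l_def)
        then show ?thesis
          using q by (simp add: algebra_simps scaleR_matrix_vector_assoc [symmetric] q_def field_simps)
      qed simp
    qed
    then have key: "w \<bullet> (C *v v) = l * (w \<bullet> (A *v v))" if "w \<in> S" for w
      using that by (simp add: algebra_simps scaleR_matrix_vector_assoc [symmetric])
    define S' where "S' = S \<inter> {w. w \<bullet> (A *v v) = 0}"
    have sub': "subspace S'"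
      unfolding S'_def
      by (intro subspace_inter sub) (auto simp: subspace_def inner_add_left)
    have "v \<notin> S'" using v1 by (simp add: S'_def)
    then have "S' \<subset> S" using vS by (auto simp: S'_def)
    then have dimlt: "dim S' < dim S"
      using sub sub' by (metis dim_psubset span_eq_iff)
    obtain B where B: "finite B" "card B = dim S'" "span B = S'"
        "\<And>v. v\<in>B \<Longrightarrow> v \<bullet> (A *v v) = 1"
        "\<And>v w. v\<in>B \<Longrightarrow> w\<in>B \<Longrightarrow> v \<noteq> w \<Longrightarrow> v \<bullet> (A *v w) = 0 \<and> v \<bullet> (C *v w) = 0"
      using less.hyps[OF dimlt sub'] by blast
    have BS: "w \<in> S \<and> w \<bullet> (A *v v) = 0" if "w \<in> B" for w
      using B(3) span_base[OF that] by (auto simp: S'_def)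
    have sp: "span (insert v B) = S"
    proof
      show "span (insert v B) \<subseteq> S"
        using BS vS by (intro span_minimal sub) auto
      show "S \<subseteq> span (insert v B)"
      proof
        fix w assume w: "w \<in> S"
        let ?a = "w \<bullet> (A *v v)"
        have "w - ?a *\<^sub>R v \<in> span B"
          unfolding B(3) S'_def using w vS sub v1
          by (simp add: subspace_diff subspace_scale inner_diff_left)
        then show "w \<in> span (insert v B)"
          by (auto simp: span_insert)
      qed
    qed
    have vB: "v \<notin> B" using BS v1 by auto
    \<comment> \<open>Spanning gives this inequality; the reverse one follows from
      \<open>card B = dim S'\<close> and \<open>dim S' < dim S\<close>.\<close>
    have "dim S \<le> card (insert v B)"
      unfolding sp [symmetric] dim_span using B(1) by (intro dim_le_card') simp
    then have card: "card (insert v B) = dim S"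
      using dimlt B vB by simp
    have sw: "v \<bullet> (A *v w) = 0 \<and> v \<bullet> (C *v w) = 0 \<and> w \<bullet> (A *v v) = 0 \<and> w \<bullet> (C *v v) = 0" if "w \<in> B" for w
    proof -
      have 1: "w \<bullet> (A *v v) = 0" "w \<bullet> (C *v v) = 0"
        using BS[OF that] key[of w] by auto
      then show ?thesis
        using dot_symmetric_matrix[OF symA, of w v] dot_symmetric_matrix[OF C, of w v]
        by (simp add: inner_commute)
    qed
    show ?thesis
      using B sp card sw v1 by (intro exI[of _ "insert v B"]) (auto simp del: card_insert_disjoint)
  qed
qed

text \<open>The columns of \<open>T\<close> are the vectors \<open>f j\<close> of a simultaneously
  orthogonal basis, so the congruence by \<open>T\<close> has the entries
  \<open>f i \<bullet> (M *v f j)\<close>.\<close>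

lemma simultaneous_diagonalization:
  fixes A C :: "real^'n^'n"
  assumes A: "pos_def A" and C: "transpose C = C"
  obtains T :: "real^'n^'n" and d :: "'n \<Rightarrow> real"
  where "transpose T ** A ** T = mat 1" "transpose T ** C ** T = (\<chi> i j. if i = j then d i else 0)"
proof -
  obtain B where B: "finite B" "card B = dim (UNIV :: (real^'n) set)"
        "\<And>v. v\<in>B \<Longrightarrow> v \<bullet> (A *v v) = 1"
        "\<And>v w. v\<in>B \<Longrightarrow> w\<in>B \<Longrightarrow> v \<noteq> w \<Longrightarrow> v \<bullet> (A *v w) = 0 \<and> v \<bullet> (C *v w) = 0"
    using simultaneous_orthogonal_basis[OF A C subspace_UNIV] by blast
  have "card B = card (UNIV :: 'n set)" using B(2) by simp
  then obtain f where f: "bij_betw f (UNIV :: 'n set) B"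
    using B(1) by (metis finite_same_card_bij finite)
  have fB: "f i \<in> B" "f i = f j \<longleftrightarrow> i = j" for i j
    using f by (auto simp: bij_betw_def inj_def)
  have on: "f i \<bullet> (A *v f j) = (if i = j then 1 else 0)"
      "i \<noteq> j \<Longrightarrow> f i \<bullet> (C *v f j) = 0" for i j
    using B(3,4)[OF fB(1)] fB by presburger+
  define T where "T = (\<chi> i j. f j $ i)"
  have ent: "(transpose T ** M ** T) $ i $ j = f i \<bullet> (M *v f j)" for M :: "real^'n^'n" and i j
    by (simp add: T_def matrix_matrix_mult_def transpose_def matrix_vector_mult_def inner_vec_def
        sum_distrib_left sum_distrib_right mult.assoc) (rule sum.swap)
  show thesis
  proof (rule that)
    show "transpose T ** A ** T = mat 1"
      unfolding vec_eq_iff ent by (simp add: mat_def on(1))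
    show "transpose T ** C ** T = (\<chi> i j. if i = j then f i \<bullet> (C *v f i) else 0)"
      unfolding vec_eq_iff ent by (simp add: on(2))
  qed
qed

lemma pos_def_det_pos:
  fixes A :: "real^'n^'n"
  assumes "pos_def A" shows "0 < det A"
proof -
  obtain T :: "real^'n^'n" where "transpose T ** A ** T = mat 1"
    by (rule simultaneous_diagonalization[OF assms, of A]) (use assms pos_def_def in blast)+
  then have "det (transpose T ** A ** T) = 1" by simp
  then have "det A * (det T)\<^sup>2 = 1"
    by (simp add: det_mul power2_eq_square mult_ac)
  then show ?thesis
    by (metis not_less mult_nonpos_nonneg zero_le_power2 not_one_le_zero)
qed

text \<open>In coordinates where \<open>A\<close> is the identity and \<open>C\<close> is diagonal
  with entries \<open>l i\<close>, the claim rests on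
  \<open>l i \<le> ((1 + l i) / 2)\<^sup>2\<close>, which is strict where \<open>l i\<close> differs
  from 1. The common lower bound \<open>d\<close> serves for comparison with a maximal
  determinant.\<close>

lemma det_midpoint_gt:
  fixes A C :: "real^'n^'n"
  assumes A: "pos_def A" and C: "pos_def C" and "A \<noteq> C"
    and d: "0 < d" "d \<le> det A" "d \<le> det C"
  shows "d < det ((1/2) *\<^sub>R (A + C))"
proof -
  obtain T :: "real^'n^'n" and l
    where T: "transpose T ** A ** T = mat 1"
      and TC: "transpose T ** C ** T = (\<chi> i j. if i = j then l i else 0)"
    by (rule simultaneous_diagonalization[OF A, of C]) (use C pos_def_def in blast)+
  let ?G = "(1/2) *\<^sub>R (A + C)"
  have TG: "transpose T ** ?G ** T = (\<chi> i j. if i = j then (1 + l i) / 2 else 0)"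
  proof -
    have "transpose T ** ?G ** T = (1/2) *\<^sub>R (transpose T ** A ** T + transpose T ** C ** T)"
      by (simp add: matrix_add_ldistrib matrix_add_rdistrib matrix_scalar_ac
          scalar_matrix_assoc[symmetric] scaleR_add_right)
    also have "\<dots> = (\<chi> i j. if i = j then (1 + l i) / 2 else 0)"
      by (auto simp: T TC vec_eq_iff mat_def)
    finally show ?thesis .
  qed
  have dA: "det A * (det T)\<^sup>2 = 1"
    using arg_cong[OF T, of det] by (simp add: det_mul power2_eq_square mult_ac)
  have dC: "det C * (det T)\<^sup>2 = (\<Prod>i\<in>UNIV. l i)"
    using arg_cong[OF TC, of det] by (simp add: det_mul power2_eq_square mult_ac det_diagonal)
  have dG: "det ?G * (det T)\<^sup>2 = (\<Prod>i\<in>UNIV. (1 + l i) / 2)"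
    using arg_cong[OF TG, of det] by (simp add: det_mul power2_eq_square mult_ac det_diagonal)
  have T0: "0 < (det T)\<^sup>2" using dA by (metis mult_zero_right zero_neq_one zero_less_power2 zero_power2)
  have lpos: "0 < l i" for i
  proof -
    have invT: "invertible T" using T0 by (simp add: invertible_det_nz)
    have "(transpose T ** C ** T) $ i $ i = axis i 1 \<bullet> ((transpose T ** C ** T) *v axis i 1)"
      by (simp add: matrix_vector_mult_basis inner_axis' column_def)
    also have "\<dots> = ((C *v (T *v axis i 1)) v* T) \<bullet> axis i 1"
      by (simp add: matrix_vector_mul_assoc [symmetric] inner_commute)
    also have "\<dots> = (T *v axis i 1) \<bullet> (C *v (T *v axis i 1))"
      unfolding dot_lmul_matrix by (rule inner_commute)
    also have "\<dots> > 0"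
      using C inj_matrix_vector_mult[OF invT] unfolding pos_def_def
      by (metis axis_eq_0_iff injD matrix_vector_mult_0_right zero_neq_one)
    finally show ?thesis by (simp add: TC)
  qed
  obtain k where k: "l k \<noteq> 1"
  proof (rule ccontr)
    assume "\<not> thesis"
    then have "\<And>i. l i = 1" using that by blast
    then have "transpose T ** C ** T = transpose T ** A ** T"
      unfolding T TC mat_def by (simp cong: if_cong)
    moreover have "invertible T" "invertible (transpose T)" using T0 by (simp_all add: invertible_det_nz)
    ultimately have "C = A"
      by (metis invertible_def matrix_mul_assoc matrix_mul_lid matrix_mul_rid)
    with \<open>A \<noteq> C\<close> show False by simp
  qed
  have sq: "l i \<le> ((1 + l i) / 2)\<^sup>2" for i
    using zero_le_power2[of "1 - l i"] by (simp add: power2_eq_square field_simps)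
  have "l k < ((1 + l k) / 2)\<^sup>2"
    using zero_less_power2[of "1 - l k"] k by (simp add: power2_eq_square field_simps)
  then have "(\<Prod>i\<in>UNIV. l i) < (\<Prod>i\<in>UNIV. ((1 + l i) / 2)\<^sup>2)"
  proof (intro prod_mono_strict[where i = k] conjI)
    show "0 < ((1 + l i) / 2)\<^sup>2" for i
      using lpos sq less_le_trans by blast
  qed (auto simp: less_imp_le lpos sq)
  then have "det C * (det T)\<^sup>2 < (det ?G * (det T)\<^sup>2)\<^sup>2"
    unfolding dC dG by (simp add: prod_power_distrib)
  then have "det C < (det ?G)\<^sup>2 * (det T)\<^sup>2"
    using mult_less_cancel_right_pos[OF T0, of "det C" "(det ?G)\<^sup>2 * (det T)\<^sup>2"]
    by (simp add: power_mult_distrib power2_eq_square[of "(det T)\<^sup>2"] mult.assoc)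
  \<comment> \<open>Multiplication by \<open>det A\<close> removes the change of coordinates, since
    \<open>det A * (det T)\<^sup>2 = 1\<close>.\<close>
  then have "det A * det C < det A * ((det ?G)\<^sup>2 * (det T)\<^sup>2)"
    using d by (intro mult_strict_left_mono) auto
  also have "\<dots> = (det ?G)\<^sup>2 * (det A * (det T)\<^sup>2)"
    by (simp only: mult_ac)
  finally have "det A * det C < (det ?G)\<^sup>2"
    using dA by simp
  moreover have "d * d \<le> det A * det C"
    using d by (intro mult_mono) auto
  ultimately have "d\<^sup>2 < (det ?G)\<^sup>2"
    by (simp add: power2_eq_square)
  moreover have "0 < det ?G"
    using pos_def_convex[OF A C, of "1/2" "1/2"] by (intro pos_def_det_pos) (simp add: scaleR_add_right)
  ultimately show ?thesis
    by (intro power_less_imp_less_base[of d 2]) auto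
qed

section \<open>Determinant perturbation and the Lyapunov equation\<close>

text \<open>In the Leibniz expansion the product rule leaves one factor from \<open>N\<close> and
  the others from the identity matrix. A permutation other than \<open>id\<close> moves at least two
  indices, so an off-diagonal zero remains; only \<open>id\<close> contributes, and it gives the
  trace.\<close>

lemma has_derivative_det_id:
  "((\<lambda>t. det (mat 1 + t *\<^sub>R (N :: real^'n^'n))) has_real_derivative trace N) (at 0)"
proof -
  define G where "G = (\<lambda>p t. \<Prod>i\<in>UNIV. (mat 1 + t *\<^sub>R N) $ i $ p i)"
  have G: "(G p has_real_derivative
      (\<Sum>i\<in>UNIV. N $ i $ p i * (\<Prod>j\<in>UNIV-{i}. (mat 1 :: real^'n^'n) $ j $ p j))) (at 0)" for p
  proof -
    have "(G p has_derivative
      (\<lambda>h. \<Sum>i\<in>UNIV. (h * N $ i $ p i) * (\<Prod>j\<in>UNIV-{i}. (mat 1 + 0 *\<^sub>R N) $ j $ p j))) (at 0)"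
      unfolding G_def by (rule has_derivative_prod) (auto intro!: derivative_eq_intros)
    then show ?thesis
      unfolding has_field_derivative_def
      by (rule has_derivative_eq_rhs) (simp add: fun_eq_iff sum_distrib_left mult_ac)
  qed
  have other: "(\<Sum>i\<in>UNIV. N $ i $ p i * (\<Prod>j\<in>UNIV-{i}. (mat 1 :: real^'n^'n) $ j $ p j)) = 0"
    if p: "p permutes UNIV" "p \<noteq> id" for p
  proof (rule sum.neutral, rule ballI)
    fix i
    have "\<exists>j. j \<noteq> i \<and> p j \<noteq> j"
    proof (rule ccontr)
      assume "\<not> ?thesis"
      then have fixed: "\<And>j. j \<noteq> i \<Longrightarrow> p j = j" by blast
      then have "p i = i"
        using permutes_inj[OF p(1)] by (metis injD)
      with fixed have "p = id" by (metis eq_id_iff)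
      with p show False by simp
    qed
    then obtain j where "j \<noteq> i" "p j \<noteq> j" by blast
    then have "(\<Prod>j\<in>UNIV-{i}. (mat 1 :: real^'n^'n) $ j $ p j) = 0"
      by (intro prod_zero) (auto intro!: bexI[of _ j] simp: mat_def)
    then show "N $ i $ p i * (\<Prod>j\<in>UNIV-{i}. (mat 1 :: real^'n^'n) $ j $ p j) = 0"
      by simp
  qed
  have "((\<lambda>t. \<Sum>p\<in>{p. p permutes UNIV}. of_int (sign p) * G p t) has_real_derivative
      (\<Sum>p\<in>{p. p permutes UNIV}. of_int (sign p) *
        (\<Sum>i\<in>UNIV. N $ i $ p i * (\<Prod>j\<in>UNIV-{i}. (mat 1 :: real^'n^'n) $ j $ p j)))) (at 0)"
    by (intro DERIV_sum DERIV_cmult G)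
  also have "(\<Sum>p\<in>{p. p permutes UNIV}. of_int (sign p) *
        (\<Sum>i\<in>UNIV. N $ i $ p i * (\<Prod>j\<in>UNIV-{i}. (mat 1 :: real^'n^'n) $ j $ p j)))
      = (\<Sum>p\<in>{id}. of_int (sign p) *
        (\<Sum>i\<in>UNIV. N $ i $ p i * (\<Prod>j\<in>UNIV-{i}. (mat 1 :: real^'n^'n) $ j $ p j)))"
    by (rule sum.mono_neutral_right) (auto simp: other permutes_id)
  also have "\<dots> = trace N"
    by (simp add: trace_def mat_def)
  finally show ?thesis
    by (simp add: det_def G_def)
qed

text \<open>Factor \<open>A + t *\<^sub>R M\<close> as \<open>A ** (mat 1 + t *\<^sub>R N)\<close>;
  the determinant of the second factor has derivative \<open>trace N\<close> at 0.\<close>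

lemma det_perturb_gt:
  fixes A M :: "real^'n^'n"
  assumes "0 < det A" "A ** N = M" "0 < trace N"
  shows "\<forall>\<^sub>F t in at_right 0. det A < det (A + t *\<^sub>R M)"
proof -
  obtain e where e: "0 < e" "\<And>t. 0 < t \<Longrightarrow> t < e \<Longrightarrow> 1 < det (mat 1 + t *\<^sub>R N)"
    using DERIV_pos_inc_right[OF has_derivative_det_id assms(3)] by auto
  have "det A < det (A + t *\<^sub>R M)" if "0 < t" "t < e" for t
  proof -
    have "A + t *\<^sub>R M = A ** (mat 1 + t *\<^sub>R N)"
      by (simp add: matrix_add_ldistrib matrix_scalar_ac scalar_matrix_assoc [symmetric] assms(2))
    then show ?thesis
      using e(2)[OF that] assms(1) by (simp add: det_mul)
  qed
  then show ?thesis
    using e(1) unfolding eventually_at_right_field by auto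
qed

section \<open>Orthogonal curves with prescribed velocity and the Lyapunov equation\<close>

lemma matrix_tendstoI:
  fixes A :: "real^'n^'m"
  assumes "\<And>x. ((\<lambda>t. f t *v x) \<longlongrightarrow> A *v x) F"
  shows "(f \<longlongrightarrow> A) F"
proof (intro vec_tendstoI)
  fix i j
  show "((\<lambda>t. f t $ i $ j) \<longlongrightarrow> A $ i $ j) F"
    using tendsto_vec_nth[OF assms[of "axis j 1"], of i]
    by (simp add: matrix_vector_mult_basis column_def)
qed

text \<open>The curve is the Cayley transform of \<open>t S / 2\<close>.\<close>

lemma orthogonal_curve:
  fixes S :: "real^'n^'n"
  assumes S: "transpose S = - S"
  obtains V :: "real \<Rightarrow> real^'n^'n"
  where "\<And>t. orthogonal_matrix (V t)" "((\<lambda>t. (1 / t) *\<^sub>R (V t - mat 1)) \<longlongrightarrow> S) (at_right 0)"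
proof -
  define R where "R t = (t / 2) *\<^sub>R S" for t
  \<comment> \<open>The quadratic form of a skew matrix vanishes. This makes
    \<open>mat 1 - R t\<close> injective and later shows that its inverse \<open>W t\<close> does
    not increase norms.\<close>
  have skew: "x \<bullet> ((mat 1 - R t) *v x) = x \<bullet> x" for x t
  proof -
    have "x \<bullet> (S *v x) = (x v* S) \<bullet> x" by (simp add: dot_lmul_matrix)
    also have "x v* S = - (S *v x)"
      unfolding transpose_matrix_vector [symmetric] S
      by (simp add: matrix_vector_mult_def vec_eq_iff sum_negf)
    finally have "x \<bullet> (S *v x) = 0" by (simp add: inner_commute)
    then show ?thesis
      by (simp add: R_def algebra_simps scaleR_matrix_vector_assoc [symmetric])
  qed
  have "invertible (mat 1 - R t)" for t
    using skew[of _ t] by (metis inner_eq_zero_iff inner_zero_right invertible_left_inverse matrix_left_invertible_ker)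
  then obtain W where W: "\<And>t. (mat 1 - R t) ** W t = mat 1" "\<And>t. W t ** (mat 1 - R t) = mat 1"
    unfolding invertible_def by metis
  define V where "V t = (mat 1 + R t) ** W t" for t
  show thesis
  proof
    fix t
    have tR: "transpose (mat 1 - R t) = mat 1 + R t" "transpose (mat 1 + R t) = mat 1 - R t"
      by (simp_all add: R_def transpose_diff transpose_add transpose_scalar S)
    have W': "transpose (W t) ** (mat 1 + R t) = mat 1"
      using arg_cong[OF W(1)[of t], of transpose] by (simp add: matrix_transpose_mul tR)
    have comm: "(mat 1 - R t) ** (mat 1 + R t) = (mat 1 + R t) ** (mat 1 - R t)"
      by (simp add: matrix_add_ldistrib matrix_add_rdistrib matrix_diff_ldistrib matrix_diff_rdistrib)
    have "transpose (V t) ** V t = transpose (W t) ** ((mat 1 - R t) ** (mat 1 + R t)) ** W t"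
      by (simp add: V_def matrix_transpose_mul tR matrix_mul_assoc)
    also have "\<dots> = (transpose (W t) ** (mat 1 + R t)) ** ((mat 1 - R t) ** W t)"
      unfolding comm by (simp only: matrix_mul_assoc)
    finally show "orthogonal_matrix (V t)"
      by (simp add: orthogonal_matrix W W')
  next
    have lim: "(W \<longlongrightarrow> mat 1) (at_right 0)"
    proof (rule matrix_tendstoI)
      fix x :: "real^'n"
      obtain C where C0: "0 < C" and C: "\<And>x. norm (S *v x) \<le> norm x * C"
        using bounded_linear.pos_bounded[OF matrix_vector_mul_bounded_linear[of S]] by blast
      \<comment> \<open>Together with the norm bound on \<open>W t\<close>, this fixed-point form
        shows that \<open>W t *v x - x\<close> is of order \<open>t\<close>.\<close>
      have eq: "W t *v x = x + (t / 2) *\<^sub>R (S *v (W t *v x))" for t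
        using arg_cong[OF W(1)[of t], of "\<lambda>A. A *v x"]
        by (simp add: matrix_vector_mul_assoc [symmetric] R_def algebra_simps scaleR_matrix_vector_assoc)
      have nW: "norm (W t *v x) \<le> norm x" for t
      proof -
        have "(norm (W t *v x))\<^sup>2 = (W t *v x) \<bullet> ((mat 1 - R t) *v (W t *v x))"
          unfolding skew by (simp add: power2_norm_eq_inner)
        also have "\<dots> = (W t *v x) \<bullet> x"
          by (simp add: matrix_vector_mul_assoc W)
        also have "\<dots> \<le> norm (W t *v x) * norm x" by (rule norm_cauchy_schwarz)
        finally show ?thesis
          by (cases "W t *v x = 0") (auto simp: power2_eq_square)
      qed
      have "((\<lambda>t. W t *v x - x) \<longlongrightarrow> 0) (at_right 0)"
      proof (rule Lim_null_comparison)
        show "\<forall>\<^sub>F t in at_right 0. norm (W t *v x - x) \<le> t * (norm x * C)"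
          using eventually_at_right_less[of 0]
        proof eventually_elim
          case (elim t)
          have "norm (W t *v x - x) = norm ((t / 2) *\<^sub>R (S *v (W t *v x)))"
            using eq[of t] by (metis add_diff_cancel_left')
          also have "\<dots> \<le> t * norm (S *v (W t *v x))"
            using elim by (simp add: mult_right_mono)
          also have "\<dots> \<le> t * (norm x * C)"
            using elim C0 by (intro mult_left_mono order_trans[OF C] mult_right_mono nW) auto
          finally show ?case .
        qed
        show "((\<lambda>t. t * (norm x * C)) \<longlongrightarrow> 0) (at_right 0)"
          by (rule tendsto_eq_intros tendsto_ident_at | simp)+
      qed
      then show "((\<lambda>t. W t *v x) \<longlongrightarrow> mat 1 *v x) (at_right 0)"
        by (simp add: LIM_zero_iff)
    qed
    have "((\<lambda>t. S ** W t) \<longlongrightarrow> S) (at_right 0)"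
      using tendsto_matrix_matrix[OF tendsto_const lim, of S] by simp
    moreover have "\<forall>\<^sub>F t in at_right 0. S ** W t = (1 / t) *\<^sub>R (V t - mat 1)"
      using eventually_at_right_less[of 0]
    proof eventually_elim
      case (elim t)
      have "V t - mat 1 = (mat 1 + R t) ** W t - (mat 1 - R t) ** W t"
        by (simp add: V_def W)
      also have "\<dots> = t *\<^sub>R (S ** W t)"
        by (simp add: R_def matrix_add_rdistrib matrix_diff_rdistrib scalar_matrix_assoc [symmetric]
            scaleR_left_distrib [symmetric])
      finally show ?case using elim by simp
    qed
    ultimately show "((\<lambda>t. (1 / t) *\<^sub>R (V t - mat 1)) \<longlongrightarrow> S) (at_right 0)"
      by (rule Lim_transform_eventually)
  qed
qed

text \<open>The operator \<open>T\<close> is injective, hence surjective: the inner product of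
  \<open>S\<close> with \<open>T S\<close> is a sum of values of the form of \<open>P\<close> at the
  rows and columns of \<open>S\<close>. The solution is skew because \<open>transpose S\<close>
  solves the equation for \<open>- W\<close>, so that \<open>S + transpose S\<close> lies in the
  kernel.\<close>

lemma lyapunov_skew:
  fixes P W :: "real^'n^'n"
  assumes P: "pos_def P" and W: "transpose W = - W"
  obtains S where "transpose S = - S" "P ** S + S ** P = W"
proof -
  define T where "T S = P ** S + S ** P" for S :: "real^'n^'n"
  have symP: "transpose P = P" using P by (simp add: pos_def_def)
  have lin: "linear T"
    unfolding T_def by (auto intro!: linearI simp: matrix_add_ldistrib matrix_add_rdistrib
      scalar_matrix_assoc [symmetric] matrix_scalar_ac scaleR_add_right)
  have right: "S \<bullet> (S ** P) = (\<Sum>i\<in>UNIV. S $ i \<bullet> (P *v (S $ i)))" for S :: "real^'n^'n"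
  proof -
    have "(S ** P) $ i = P *v (S $ i)" for i
    proof -
      have "(S ** P) $ i = (S $ i) v* P"
        by (simp add: matrix_matrix_mult_def vector_matrix_mult_def vec_eq_iff)
      also have "\<dots> = P *v (S $ i)"
        by (metis symP transpose_matrix_vector)
      finally show ?thesis .
    qed
    then show ?thesis by (simp add: inner_vec_def [of S])
  qed
  have tr: "transpose S \<bullet> transpose R = S \<bullet> R" for S R :: "real^'n^'n"
    unfolding inner_vec_def transpose_def by simp (rule sum.swap)
  have left: "S \<bullet> (P ** S) = (\<Sum>i\<in>UNIV. transpose S $ i \<bullet> (P *v (transpose S $ i)))" for S :: "real^'n^'n"
    using right[of "transpose S"] tr[of S "P ** S"] by (simp add: matrix_transpose_mul symP)
  have nonneg: "0 \<le> x \<bullet> (P *v x)" for x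
    using P by (cases "x = 0") (auto simp: pos_def_def less_imp_le)
  have ker: "S = 0" if "T S = 0" for S
  proof -
    have "0 = S \<bullet> (P ** S) + S \<bullet> (S ** P)"
      using that by (simp add: T_def inner_add_right [symmetric])
    moreover have "0 \<le> S \<bullet> (P ** S)" "0 \<le> S \<bullet> (S ** P)"
      unfolding left right by (auto intro!: sum_nonneg nonneg)
    ultimately have "(\<Sum>i\<in>UNIV. S $ i \<bullet> (P *v (S $ i))) = 0"
      unfolding right by linarith
    then have "S $ i \<bullet> (P *v (S $ i)) = 0" for i
      by (simp add: sum_nonneg_eq_0_iff nonneg)
    then have "S $ i = 0" for i
      using P unfolding pos_def_def by (metis less_irrefl)
    then show "S = 0" by (simp add: vec_eq_iff)
  qed
  then have "inj T" using lin by (simp add: linear_injective_0)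
  then have "surj T" using lin by (simp add: linear_injective_imp_surjective)
  then obtain S where S: "T S = W" by (metis surjD)
  have "T (transpose S) = transpose (T S)"
    by (simp add: T_def transpose_add matrix_transpose_mul symP add.commute)
  then have "T (S + transpose S) = 0"
    using lin S W by (simp add: linear_add)
  then have "S + transpose S = 0" by (rule ker)
  then have "transpose S = - S" by (simp add: eq_neg_iff_add_eq_0 add.commute)
  with S show thesis by (intro that) (simp_all add: T_def)
qed

section \<open>Volumes of affine images\<close>

text \<open>Translating along coordinate \<open>n\<close> makes the lower bound there 0, as
  \<open>measure_shear_interval\<close> requires a nonnegative one; the shear is linear and so turns
  this translation into another one.\<close>

lemma measure_shear_cbox:
  fixes a b :: "real^'n"
  assumes "m \<noteq> n"
  shows "measure lebesgue ((\<lambda>x. \<chi> i. if i = m then x $ m + x $ n else x $ i) ` cbox a b) = measure lebesgue (cbox a b)"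
proof (cases "cbox a b = {}")
  case False
  let ?h = "\<lambda>x :: real^'n. \<chi> i. if i = m then x $ m + x $ n else x $ i"
  define t where "t = axis n (a $ n)"
  have box: "cbox a b = (+) t ` cbox (a - t) (b - t)"
    using cbox_translation[of t "a - t" "b - t"] by simp
  have "?h ` cbox a b = (+) (?h t) ` ?h ` cbox (a - t) (b - t)"
    unfolding box image_image by (rule image_cong) (auto simp: vec_eq_iff)
  then have "measure lebesgue (?h ` cbox a b) = measure lebesgue (?h ` cbox (a - t) (b - t))"
    by (simp only: measure_translation)
  also have "\<dots> = measure lebesgue (cbox (a - t) (b - t))"
    using False assms by (intro measure_shear_interval) (auto simp: box t_def)
  also have "\<dots> = measure lebesgue (cbox a b)"
    unfolding box by (simp only: measure_translation)
  finally show ?thesis .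
qed simp

lemma measure_permute_cbox:
  fixes a b :: "real^'n"
  assumes "p permutes UNIV"
  shows "measure lebesgue ((\<lambda>x. \<chi> i. x $ p i) ` cbox a b) = measure lebesgue (cbox a b)"
proof (cases "cbox a b = {}")
  case False
  let ?h = "\<lambda>x :: real^'n. \<chi> i. x $ p i"
  have img: "?h ` cbox a b = cbox (?h a) (?h b)"
  proof (intro equalityI subsetI)
    fix y assume y: "y \<in> cbox (?h a) (?h b)"
    have "(\<chi> i. y $ inv p i) \<in> cbox a b"
      unfolding mem_box_cart
    proof
      fix i
      show "a $ i \<le> (\<chi> i. y $ inv p i) $ i \<and> (\<chi> i. y $ inv p i) $ i \<le> b $ i"
        using y assms unfolding mem_box_cart
        by (auto dest!: spec[of _ "inv p i"] simp: permutes_inverses)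
    qed
    moreover have "y = ?h (\<chi> i. y $ inv p i)"
      using assms by (simp add: permutes_inverses vec_eq_iff)
    ultimately show "y \<in> ?h ` cbox a b" by blast
  qed (auto simp: mem_box_cart)
  have ne: "cbox (?h a) (?h b) \<noteq> {}"
    using False by (simp only: img [symmetric] image_is_empty not_False_eq_True)
  have "measure lebesgue (cbox (?h a) (?h b)) = (\<Prod>i\<in>UNIV. b $ p i - a $ p i)"
    using content_cbox_cart[OF ne] by (simp add: measure_completion)
  also have "\<dots> = (\<Prod>i\<in>UNIV. b $ i - a $ i)"
    using prod.permute[OF assms, of "\<lambda>i. b $ i - a $ i"] by (simp add: o_def)
  also have "\<dots> = measure lebesgue (cbox a b)"
    using content_cbox_cart[OF False] by (simp add: measure_completion)
  finally show ?thesis by (simp only: img)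
qed simp

text \<open>The library version \<open>measure_linear_image\<close> requires a well-ordered index type.\<close>

lemma measure_linear_image_det:
  fixes f :: "real^'n \<Rightarrow> real^'n"
  assumes "linear f" "S \<in> lmeasurable"
  shows "f ` S \<in> lmeasurable \<and> measure lebesgue (f ` S) = \<bar>det (matrix f)\<bar> * measure lebesgue S"
  using assms
proof (induction f arbitrary: S rule: induct_linear_elementary [consumes 1])
  case (1 f g)
  moreover have "(f \<circ> g) ` S = f ` g ` S" by (rule image_comp [symmetric])
  moreover have "matrix (f \<circ> g) = matrix f ** matrix g" using 1 by (simp only: matrix_compose)
  ultimately show ?case
    by (simp only: det_mul abs_mult mult.assoc)
next
  case (2 f i)
  \<comment> \<open>Every value of \<open>f\<close> has \<open>i\<close>-th component 0, so both the
    image measure and the determinant vanish.\<close>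
  then have "\<not> surj f"
    by (metis surjD vec_component zero_neq_one)
  then have "\<not> inj f" using 2 linear_injective_imp_surjective by blast
  then have "negligible (f ` S)" "det (matrix f) = 0"
    using 2 negligible_linear_singular_image det_nz_iff_inj by blast+
  then show ?case
    by (simp add: negligible_iff_measure)
next
  case (3 c)
  then show ?case
    by (simp add: measurable_stretch measure_stretch axis_def matrix_def det_diagonal)
next
  case (4 m n)
  let ?p = "Transposition.transpose m n"
  let ?h = "\<lambda>x :: real^'n. \<chi> i. x $ ?p i"
  have "linear ?h" by (rule linearI) (auto simp: vec_eq_iff)
  then have *: "?h ` S \<in> lmeasurable" "measure lebesgue S = measure lebesgue (?h ` S)"
    using measure_linear_sufficient[of ?h S 1] measure_permute_cbox[OF permutes_swap_id] 4 by auto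
  have "matrix ?h = (\<chi> i. mat 1 $ ?p i)"
    by (auto simp: vec_eq_iff matrix_def mat_def axis_def)
  then have "\<bar>det (matrix ?h)\<bar> = 1"
    by (simp add: det_permute_rows permutes_swap_id sign_swap_id)
  with * show ?case by simp
next
  case (5 m n)
  let ?h = "\<lambda>x :: real^'n. \<chi> i. if i = m then x $ m + x $ n else x $ i"
  have "linear ?h" by (rule linearI) (auto simp: vec_eq_iff algebra_simps)
  then have *: "?h ` S \<in> lmeasurable" "measure lebesgue S = measure lebesgue (?h ` S)"
    using measure_linear_sufficient[of ?h S 1] measure_shear_cbox 5 by auto
  have m: "matrix ?h = (\<chi> k. if k = m then row m (mat 1) + 1 *s row n (mat 1) else row k (mat 1))"
    by (auto simp: vec_eq_iff matrix_def mat_def axis_def row_def)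
  then have "det (matrix ?h) = 1"
    using det_row_operation[OF 5(1), of "mat 1 :: real^'n^'n" 1] unfolding m by (simp only: det_I)
  with * show ?case by simp
qed

lemma measure_affine_img:
  fixes L :: "(real^'n) set"
  assumes "convex_body L"
  shows "measure lebesgue (affine_img A z L) = \<bar>det A\<bar> * measure lebesgue L"
proof -
  have L: "L \<in> lmeasurable"
    using assms by (simp add: convex_body_def lmeasurable_compact)
  have "affine_img A z L = (+) z ` ((*v) A ` L)"
    by (simp add: affine_img_def image_image add.commute)
  then show ?thesis
    using measure_linear_image_det[of "(*v) A", OF _ L] by (simp add: measure_translation)
qed

lemma convex_body_measure_pos:
  fixes L :: "(real^'n) set"
  assumes "convex_body L"
  shows "0 < measure lebesgue L"
proof -
  have "\<not> negligible L"
    using assms negligible_subset[OF _ interior_subset] open_not_negligible[OF open_interior]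
    by (auto simp: convex_body_def)
  moreover have "L \<in> lmeasurable"
    using assms by (simp add: convex_body_def lmeasurable_compact)
  ultimately show ?thesis
    by (metis measure_nonneg negligible_iff_measure order_le_less)
qed

lemma convex_body_linear_image:
  fixes L :: "(real^'n) set"
  assumes "convex_body L" "invertible A"
  shows "convex_body ((*v) A ` L)"
proof -
  have "interior ((*v) A ` L) = (*v) A ` interior L"
    using assms(2) by (intro interior_bijective_linear_image) (auto simp: invertible_eq_bij)
  then show ?thesis
    using assms(1) unfolding convex_body_def
    by (auto intro!: convex_linear_image compact_continuous_image continuous_intros)
qed

section \<open>Positive John images\<close>

text \<open>A ball inside \<open>M\<close> must be mapped into the bounded set \<open>K\<close>,
  which bounds the matrix and then the translation. The matrices are arbitrary so that products of a
  positive definite and an orthogonal matrix are covered.\<close>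

lemma compact_affine_fits:
  fixes K M :: "(real^'n) set"
  assumes K: "compact K" and M: "interior M \<noteq> {}"
  shows "compact {p. affine_img (fst p) (snd p) M \<subseteq> K}"
proof -
  let ?G = "{p. affine_img (fst p) (snd p) M \<subseteq> K}"
  have "?G = (\<Inter>x\<in>M. (\<lambda>p. fst p *v x + snd p) -` K)"
    by (auto simp: affine_img_def)
  moreover have "closed ((\<lambda>p. fst p *v x + snd p) -` K)" for x :: "real^'n"
    using K by (intro closed_vimage continuous_intros compact_imp_closed)
  ultimately have "closed ?G" by auto
  moreover have "bounded ?G"
  proof -
    obtain a r where r: "0 < r" "cball a r \<subseteq> M"
      using M by (auto simp: mem_interior_cball)
    obtain R where R: "\<And>x. x \<in> K \<Longrightarrow> norm x \<le> R"
      using compact_imp_bounded[OF K] by (auto simp: bounded_iff)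
    obtain C where C: "0 \<le> C" "\<And>(Q :: real^'n^'n) x. norm (Q *v x) \<le> norm Q * norm x * C"
      using bounded_bilinear.nonneg_bounded[OF bounded_bilinear_matrix_vector [where 'm = 'n and 'n = 'n]] by blast
    define B where "B = real CARD('n) * (real CARD('n) * (2 * R / r))"
    show ?thesis
    proof (rule boundedI)
      fix p assume "p \<in> ?G"
      then obtain Q z where p: "p = (Q, z)" and fit: "\<And>x. x \<in> M \<Longrightarrow> Q *v x + z \<in> K"
        by (cases p) (auto simp: affine_img_def)
      have aM: "a \<in> M" using r by auto
      have ent: "\<bar>Q $ i $ j\<bar> \<le> 2 * R / r" for i j
      proof -
        \<comment> \<open>The images of \<open>a\<close> and of this point both lie in
          \<open>K\<close>, hence at distance at most \<open>2 * R\<close>; this bounds column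
          \<open>j\<close> of \<open>Q\<close>.\<close>
        have "a + r *\<^sub>R axis j 1 \<in> M"
          using r by (intro subsetD[OF r(2)]) (simp add: dist_norm)
        then have "norm (Q *v (a + r *\<^sub>R axis j 1) + z) \<le> R" "norm (Q *v a + z) \<le> R"
          using fit R aM by blast+
        then have "norm ((Q *v (a + r *\<^sub>R axis j 1) + z) - (Q *v a + z)) \<le> 2 * R"
          using norm_triangle_ineq4 by smt
        then have "r * norm (Q *v axis j 1) \<le> 2 * R"
          using r by (simp add: algebra_simps)
        moreover have "\<bar>Q $ i $ j\<bar> \<le> norm (Q *v axis j 1)"
          using component_le_norm_cart[of "Q *v axis j 1" i]
          by (simp add: matrix_vector_mult_basis column_def)
        ultimately have "r * \<bar>Q $ i $ j\<bar> \<le> 2 * R"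
          using r by (smt mult_left_mono)
        then show ?thesis using r by (simp add: field_simps)
      qed
      have "norm Q \<le> (\<Sum>i\<in>UNIV. norm (Q $ i))"
        unfolding norm_vec_def[of Q] by (rule L2_set_le_sum) simp
      also have "\<dots> \<le> (\<Sum>i\<in>(UNIV::'n set). \<Sum>j\<in>(UNIV::'n set). 2 * R / r)"
        by (intro sum_mono order_trans[OF norm_le_l1_cart] ent)
      finally have nQ: "norm Q \<le> B" by (simp add: B_def)
      have "norm z \<le> norm (Q *v a + z) + norm (Q *v a)"
        by (metis add.commute add_diff_cancel_left' norm_triangle_ineq4 add.commute)
      also have "\<dots> \<le> R + B * norm a * C"
        using nQ C(1) by (intro add_mono R fit aM order_trans[OF C(2)] mult_right_mono) auto
      finally show "norm p \<le> B + (R + B * norm a * C)"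
        using nQ norm_Pair_le[of Q z] p by simp
    qed
  qed
  ultimately show ?thesis by (simp add: compact_eq_bounded_closed)
qed

text \<open>The maximality of a John pair in terms of determinants, to which the volumes of affine
  images of \<open>M\<close> are proportional.\<close>

definition john_max :: "(real^'n) set \<Rightarrow> (real^'n) set \<Rightarrow> real^'n^'n \<Rightarrow> real^'n \<Rightarrow> bool" where
  "john_max K M P z \<longleftrightarrow> pos_def P \<and> affine_img P z M \<subseteq> K \<and>
     (\<forall>Q w. pos_def Q \<longrightarrow> affine_img Q w M \<subseteq> K \<longrightarrow> det Q \<le> det P)"

lemma positive_john_image_iff:
  assumes "convex_body M"
  shows "pos_def P \<and> positive_john_image K M (affine_img P z M) \<longleftrightarrow> john_max K M P z"
proof -
  have "measure lebesgue (affine_img Q w M) \<le> measure lebesgue (affine_img P z M) \<longleftrightarrow> det Q \<le> det P"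
    if "pos_def P" "pos_def Q" for Q w
    using that convex_body_measure_pos[OF assms] pos_def_det_pos[of P] pos_def_det_pos[of Q]
    by (simp add: measure_affine_img[OF assms])
  then show ?thesis
    unfolding john_max_def positive_john_image_def positive_image_def by blast
qed

text \<open>The determinant attains its maximum on the compact set of fitting pairs with
  semidefinite matrix. A fitting multiple of the identity makes the maximum positive, so the
  maximizer is definite.\<close>

lemma john_max_exists:
  fixes K M :: "(real^'n) set"
  assumes K: "convex_body K" and M: "convex_body M"
  shows "\<exists>P z. john_max K M P z"
proof -
  define X where "X = {p. affine_img (fst p) (snd p) M \<subseteq> K} \<inter>
    ({p. transpose (fst p) = fst p} \<inter> (\<Inter>x. {p. 0 \<le> x \<bullet> (fst p *v x)}))"
  have "compact X"
    unfolding X_def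
  proof (intro compact_Int_closed compact_affine_fits closed_Int closed_INT ballI closed_Collect_le closed_Collect_eq continuous_intros)
    show "continuous_on UNIV (\<lambda>p :: (real^'n^'n) \<times> (real^'n). transpose (fst p))"
      unfolding continuous_on_def by (intro ballI tendsto_intros)
  qed (use K M in \<open>auto simp: convex_body_def\<close>)
  moreover obtain \<epsilon> c where \<epsilon>: "0 < \<epsilon>" and init: "(\<epsilon> *\<^sub>R mat 1, c) \<in> X"
  proof -
    obtain c r where r: "0 < r" "cball c r \<subseteq> K"
      using K by (auto simp: convex_body_def mem_interior_cball)
    obtain R where R: "0 < R" "\<And>x. x \<in> M \<Longrightarrow> norm x \<le> R"
      using M compact_imp_bounded[of M] unfolding convex_body_def bounded_pos by blast
    show thesis
    \<comment> \<open>Scaling by \<open>r / R\<close> takes \<open>M\<close> from the ball of radius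
      \<open>R\<close> about 0 into that of radius \<open>r\<close>, which fits into
      \<open>K\<close> around \<open>c\<close>.\<close>
    proof (rule that[of "r / R" c])
      have "(r / R) *\<^sub>R x + c \<in> K" if "x \<in> M" for x
      proof (rule subsetD[OF r(2)])
        have "r / R * norm x \<le> r / R * R"
          using R r that by (intro mult_left_mono) auto
        then show "(r / R) *\<^sub>R x + c \<in> cball c r"
          using R r by (simp add: dist_norm)
      qed
      then show "((r / R) *\<^sub>R mat 1, c) \<in> X"
        using R r by (auto simp: X_def affine_img_def transpose_scalar scaleR_matrix_vector_assoc [symmetric])
    qed (use r R in simp)
  qed
  moreover have "continuous_on X (\<lambda>p. det (fst p))"
    by (intro continuous_intros)
  ultimately obtain p where p: "p \<in> X" and pmax: "\<And>q. q \<in> X \<Longrightarrow> det (fst q) \<le> det (fst p)"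
    using continuous_attains_sup[of X "\<lambda>p. det (fst p)"] by blast
  have in_X: "(Q, w) \<in> X" if "pos_def Q" "affine_img Q w M \<subseteq> K" for Q w
  proof -
    have "0 \<le> x \<bullet> (Q *v x)" for x
      using that(1) by (cases "x = 0") (auto simp: pos_def_def less_imp_le)
    then show ?thesis using that by (auto simp: X_def pos_def_def)
  qed
  have "pos_def (\<epsilon> *\<^sub>R mat 1 :: real^'n^'n)"
    using \<epsilon> by (auto simp: pos_def_def transpose_scalar scaleR_matrix_vector_assoc [symmetric])
  then have "0 < det (fst p)"
    using pmax[OF init] pos_def_det_pos by fastforce
  then have "pos_def (fst p)"
    using p by (intro pos_defI) (auto simp: X_def)
  then have "john_max K M (fst p) (snd p)"
    using p pmax in_X by (fastforce simp: john_max_def X_def)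
  then show ?thesis by blast
qed

text \<open>Different matrices would give a midpoint pair of larger determinant. With equal matrices
  and different translations, \<open>K\<close> contains the convex hull of two translates of one
  body, which leaves room to stretch along \<open>w - z\<close>.\<close>

lemma john_max_unique:
  fixes K M :: "(real^'n) set"
  assumes K: "convex_body K" and M: "convex_body M"
    and max: "john_max K M P z" and Q: "pos_def Q" "affine_img Q w M \<subseteq> K" "det P \<le> det Q"
  shows "Q = P \<and> w = z"
proof -
  have P: "pos_def P" and Pfit: "\<And>x. x \<in> M \<Longrightarrow> P *v x + z \<in> K"
    using max by (auto simp: john_max_def affine_img_def)
  have Pmax: "det Q \<le> det P" if "pos_def Q" "\<And>x. x \<in> M \<Longrightarrow> Q *v x + w \<in> K" for Q w
    using max that unfolding john_max_def affine_img_def by (metis image_subsetI)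
  have Qfit: "\<And>x. x \<in> M \<Longrightarrow> Q *v x + w \<in> K" using Q by (auto simp: affine_img_def)
  have conv: "a *\<^sub>R u + (1 - a) *\<^sub>R v \<in> K" if "u \<in> K" "v \<in> K" "0 \<le> a" "a \<le> 1" for a u v
    using K that by (intro convexD) (auto simp: convex_body_def)
  have "Q = P"
  proof (rule ccontr)
    assume "Q \<noteq> P"
    then have "det P < det ((1/2) *\<^sub>R (P + Q))"
      using P Q pos_def_det_pos[OF P] by (intro det_midpoint_gt) auto
    moreover have "det ((1/2) *\<^sub>R (P + Q)) \<le> det P"
    proof (rule Pmax)
      show "pos_def ((1/2) *\<^sub>R (P + Q))"
        using pos_def_convex[OF P Q(1), of "1/2" "1/2"] by (simp add: scaleR_add_right)
      fix x assume "x \<in> M"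
      then show "((1/2) *\<^sub>R (P + Q)) *v x + ((1/2) *\<^sub>R z + (1 - 1/2) *\<^sub>R w) \<in> K"
        using conv[OF Pfit[of x] Qfit[of x], of "1/2"]
        by (simp add: scaleR_matrix_vector_assoc [symmetric] algebra_simps)
    qed
    ultimately show False by simp
  qed
  moreover have "w = z"
  proof (rule ccontr)
    assume "w \<noteq> z"
    define v where "v = w - z"
    have v: "v \<noteq> 0" using \<open>w \<noteq> z\<close> by (simp add: v_def)
    define E where "E = v \<otimes>\<^sub>o v"
    have Ev: "E *v x = (v \<bullet> x) *\<^sub>R v" for x
      by (simp add: E_def outer_prod_def matrix_vector_mult_def vec_eq_iff inner_vec_def sum_distrib_right sum_distrib_left mult_ac)
    have symE: "transpose E = E"
      by (simp add: E_def outer_prod_def transpose_def mult.commute)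
    obtain R where R: "0 < R" "\<And>x. x \<in> M \<Longrightarrow> norm x \<le> R"
      using M compact_imp_bounded[of M] unfolding convex_body_def bounded_pos by blast
    have invP: "invertible P" using pos_def_det_pos[OF P] by (simp add: invertible_det_nz)
    then obtain J where J: "P ** J = mat 1" unfolding invertible_def by blast
    \<comment> \<open>The first-order gain from adding \<open>t *\<^sub>R E\<close> is
      \<open>u \<bullet> (P *v u)\<close> for \<open>u = J *v v\<close>.\<close>
    have trJ: "0 < trace (J ** E)"
    proof -
      define u where "u = J *v v"
      have Pu: "P *v u = v" by (simp add: u_def matrix_vector_mul_assoc J)
      then have "u \<noteq> 0" using v by auto
      then have "0 < u \<bullet> v" using P Pu by (metis pos_def_def)
      also have "u \<bullet> v = trace (J ** E)"
        by (simp add: u_def trace_def E_def outer_prod_def matrix_matrix_mult_def matrix_vector_mult_def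
            inner_vec_def sum_distrib_right mult.assoc)
      finally show ?thesis .
    qed
    have "\<forall>\<^sub>F t in at_right 0. det P < det (P + t *\<^sub>R E)"
      using trJ by (intro det_perturb_gt[OF pos_def_det_pos[OF P], of "J ** E"]) (simp_all add: matrix_mul_assoc J)
    moreover have "\<forall>\<^sub>F t in at_right 0. t < 1 / (2 * (norm v * R))"
      using v R by (intro order_tendstoD(2)[OF tendsto_ident_at]) simp
    ultimately have "\<forall>\<^sub>F t in at_right (0::real). False"
      using pos_def_perturb[OF P symE] eventually_at_right_less[of 0]
    proof eventually_elim
      case (elim t)
      have "det (P + t *\<^sub>R E) \<le> det P"
      proof (rule Pmax)
        fix x assume x: "x \<in> M"
        \<comment> \<open>The weight depends on \<open>x\<close> so that the convex combination of
          the two translates is exactly the stretched image, centred at the midpoint of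
          \<open>z\<close> and \<open>w\<close>. The bound on \<open>t\<close> keeps
          \<open>a\<close> between 0 and 1.\<close>
        define a where "a = 1/2 - t * (v \<bullet> x)"
        have "\<bar>v \<bullet> x\<bar> \<le> norm v * R"
          using R(2)[OF x] by (intro order_trans[OF Cauchy_Schwarz_ineq2] mult_left_mono) auto
        then have "t * \<bar>v \<bullet> x\<bar> \<le> t * (norm v * R)"
          using elim by (intro mult_left_mono) auto
        also have "\<dots> \<le> 1/2"
          using elim v R by (simp add: field_simps)
        finally have "\<bar>t * (v \<bullet> x)\<bar> \<le> 1/2" using elim by (simp add: abs_mult)
        then have "a *\<^sub>R (P *v x + z) + (1 - a) *\<^sub>R (P *v x + w) \<in> K"
          using Pfit[OF x] Qfit[OF x] \<open>Q = P\<close> by (intro conv) (auto simp: a_def)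
        also have "a *\<^sub>R (P *v x + z) + (1 - a) *\<^sub>R (P *v x + w)
            = (P + t *\<^sub>R E) *v x + (1/2) *\<^sub>R (z + w)"
        proof -
          have "(1/2) *\<^sub>R (z + w) + (1/2) *\<^sub>R v = (1/2) *\<^sub>R (w + w)"
            by (simp only: v_def scaleR_add_right [symmetric]) simp
          then have mid: "w = (1/2) *\<^sub>R (z + w) + (1/2) *\<^sub>R v"
            by (simp only: scaleR_half_double)
          have "a *\<^sub>R (P *v x + z) + (1 - a) *\<^sub>R (P *v x + w) = P *v x + (w - a *\<^sub>R v)"
            by (simp add: v_def algebra_simps)
          also have "w - a *\<^sub>R v = (1/2) *\<^sub>R (z + w) + (t * (v \<bullet> x)) *\<^sub>R v"
            by (subst mid) (simp add: a_def scaleR_left_diff_distrib)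
          finally show ?thesis
            by (simp add: Ev matrix_vector_mult_add_rdistrib scaleR_matrix_vector_assoc [symmetric])
        qed
        finally show "(P + t *\<^sub>R E) *v x + (1/2) *\<^sub>R (z + w) \<in> K" .
      qed (fact elim)
      then show False using elim by simp
    qed
    then show False by simp
  qed
  ultimately show ?thesis by simp
qed

text \<open>Existence and uniqueness make the description in \<open>john_pair\<close>
  proper.\<close>

lemma john_max_Pstar:
  assumes "convex_body K" "convex_body L" "orthogonal_matrix U"
  shows "john_max K ((*v) U ` L) (Pstar K L U) (zstar K L U)"
proof -
  have "invertible U"
    using assms(3) by (auto simp: orthogonal_matrix_def invertible_def)
  then have M: "convex_body ((*v) U ` L)"
    using assms(2) by (intro convex_body_linear_image)
  obtain P z where P: "john_max K ((*v) U ` L) P z"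
    using john_max_exists[OF assms(1) M] by blast
  have "john_pair K L U = (P, z)"
    unfolding john_pair_def positive_john_image_iff[OF M]
  proof (rule the_equality)
    show "case (P, z) of (P, z) \<Rightarrow> john_max K ((*v) U ` L) P z" using P by simp
    fix q assume "case q of (P, z) \<Rightarrow> john_max K ((*v) U ` L) P z"
    then obtain Q w where q: "q = (Q, w)" "john_max K ((*v) U ` L) Q w" by (cases q) auto
    then show "q = (P, z)"
      using john_max_unique[OF assms(1) M P, of Q w] P by (auto simp: john_max_def)
  qed
  with P show ?thesis by (simp add: Pstar_def zstar_def)
qed

section \<open>Contact pairs\<close>

text \<open>A separating hyperplane has a negative level \<open>b\<close> because 0 lies in
  \<open>K\<close>; dividing its normal by \<open>b\<close> gives the polar vector.\<close>

lemma polar_separation: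
  assumes "closed K" "convex K" "0 \<in> K" "p \<notin> K"
  obtains y where "y \<in> polar K" "1 < p \<bullet> y"
proof -
  obtain a b where ab: "a \<bullet> p < b" "\<And>x. x \<in> K \<Longrightarrow> b < a \<bullet> x"
    using separating_hyperplane_closed_point[OF assms(2,1,4)] by blast
  have b: "b < 0" using ab(2)[OF assms(3)] by simp
  show thesis
  proof
    show "(1 / b) *\<^sub>R a \<in> polar K"
      using ab(2) b by (auto simp: polar_def inner_commute divide_simps less_imp_le)
    show "1 < p \<bullet> ((1 / b) *\<^sub>R a)"
      using ab(1) b by (simp add: inner_commute divide_simps)
  qed
qed

lemma compact_polar:
  assumes "0 \<in> interior K"
  shows "compact (polar K)"
proof -
  obtain r where r: "0 < r" "cball 0 r \<subseteq> K"
    using assms by (auto simp: mem_interior_cball)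
  have "polar K = (\<Inter>x\<in>K. {y. x \<bullet> y \<le> 1})" by (auto simp: polar_def)
  moreover have "closed (\<Inter>x\<in>K. {y. x \<bullet> y \<le> 1})"
    by (intro closed_INT ballI closed_Collect_le continuous_intros)
  moreover have bd: "norm y \<le> 1 / r" if "y \<in> polar K" for y
  proof (cases "y = 0")
    case False
    have "(r / norm y) *\<^sub>R y \<in> K"
      using False r by (intro subsetD[OF r(2)]) simp
    then have "((r / norm y) *\<^sub>R y) \<bullet> y \<le> 1"
      using that unfolding polar_def by blast
    also have "((r / norm y) *\<^sub>R y) \<bullet> y = r * norm y"
      by (simp add: power2_norm_eq_inner [symmetric] power2_eq_square)
    finally show ?thesis
      using r by (simp add: field_simps)
  qed (use r in simp)
  moreover have "bounded (polar K)" by (rule boundedI) (rule bd)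
  ultimately show ?thesis
    by (simp add: compact_eq_bounded_closed)
qed

text \<open>Moving \<open>x\<close> towards \<open>y\<close>, or \<open>y\<close> towards
  \<open>x\<close>, raises the inner product above 1, so neither can be interior to the sets in
  question.\<close>

lemma contact_pairI:
  assumes "L \<subseteq> K" "x \<in> L" "y \<in> polar K" "x \<bullet> y = 1"
  shows "contact_pair K L x y"
proof -
  have yL: "y \<in> polar L" using assms by (auto simp: polar_def)
  have notint: "x \<notin> interior S" if "y \<in> polar S" for S
  proof
    assume "x \<in> interior S"
    then obtain r where r: "0 < r" "cball x r \<subseteq> S"
      by (auto simp: mem_interior_cball)
    have y0: "y \<noteq> 0" using assms(4) by auto
    have "x + (r / norm y) *\<^sub>R y \<in> S"
      using r y0 by (intro subsetD[OF r(2)]) (simp add: dist_norm)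
    then have "(x + (r / norm y) *\<^sub>R y) \<bullet> y \<le> 1"
      using that by (simp add: polar_def)
    then have "(r / norm y) * (y \<bullet> y) \<le> 0"
      using assms(4) by (simp add: inner_add_left)
    moreover have "0 < (r / norm y) * (y \<bullet> y)"
      using r y0 by simp
    ultimately show False by simp
  qed
  have notint': "y \<notin> interior (polar S)" if "x \<in> S" for S
  proof
    assume "y \<in> interior (polar S)"
    then obtain r where r: "0 < r" "cball y r \<subseteq> polar S"
      by (auto simp: mem_interior_cball)
    have x0: "x \<noteq> 0" using assms(4) by auto
    have "y + (r / norm x) *\<^sub>R x \<in> polar S"
      using r x0 by (intro subsetD[OF r(2)]) (simp add: dist_norm)
    then have "x \<bullet> (y + (r / norm x) *\<^sub>R x) \<le> 1"
      using that by (simp add: polar_def)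
    then have "(r / norm x) * (x \<bullet> x) \<le> 0"
      using assms(4) by (simp add: inner_add_right)
    moreover have "0 < (r / norm x) * (x \<bullet> x)"
      using r x0 by simp
    ultimately show False by simp
  qed
  show ?thesis
    unfolding contact_pair_def frontier_def
    using assms yL notint[OF yL] notint[OF assms(3)] notint'[of L] notint'[of K]
      closure_subset[of L] closure_subset[of K] closure_subset[of "polar L"] closure_subset[of "polar K"]
    by blast
qed

section \<open>The first-order condition at a saddle\<close>

text \<open>Here \<open>L\<close> stands for the body already rotated by the minimizer, so the
  saddle condition compares with the identity rotation. The conclusion forbids a velocity field of
  positive trace that points strictly inwards at every contact pair.\<close>

lemma saddle_first_order:
  fixes K L :: "(real^'n) set"
  assumes K: "convex_body K" "0 \<in> interior K" and L: "convex_body L"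
    and max: "john_max K L P0 z0"
    and saddle: "\<And>V. orthogonal_matrix V \<Longrightarrow> \<exists>P z. john_max K ((*v) V ` L) P z \<and> det P0 \<le> det P"
    and B: "0 < trace B"
  shows "\<exists>x\<in>affine_img P0 z0 L. \<exists>y\<in>polar K. x \<bullet> y = 1 \<and> 0 \<le> (B *v x + b) \<bullet> y"
proof -
  have P0: "pos_def P0" and fit0: "\<And>x. x \<in> L \<Longrightarrow> P0 *v x + z0 \<in> K"
    using max by (auto simp: john_max_def affine_img_def)
  have max0: "\<exists>x\<in>L. Q *v x + w \<notin> K" if "pos_def Q" "det P0 < det Q" for Q w
  proof (rule ccontr)
    assume "\<not> ?thesis"
    then have "affine_img Q w L \<subseteq> K" by (auto simp: affine_img_def)
    with max that show False by (fastforce simp: john_max_def)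
  qed
  have symP0: "transpose P0 = P0" using P0 by (simp add: pos_def_def)
  \<comment> \<open>For skew \<open>S\<close>, the matrix \<open>B ** P0 - P0 ** S\<close> is
    symmetric exactly when \<open>P0 ** S + S ** P0 = W\<close>.\<close>
  define W where "W = B ** P0 - P0 ** transpose B"
  have "transpose W = - W"
    by (simp add: W_def transpose_diff matrix_transpose_mul symP0)
  then obtain S where S: "transpose S = - S" and lyap: "P0 ** S + S ** P0 = W"
    using lyapunov_skew[OF P0] by blast
  define M where "M = B ** P0 - P0 ** S"
  have symM: "transpose M = M"
  proof -
    have "transpose M = P0 ** transpose B - transpose S ** P0"
      by (simp add: M_def transpose_diff matrix_transpose_mul symP0)
    also have "transpose S ** P0 = P0 ** S - W"
      unfolding S lyap [symmetric] by (simp add: matrix_matrix_mult_def vec_eq_iff sum_negf)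
    finally show ?thesis by (simp add: W_def M_def)
  qed
  have "transpose (- S) = - transpose S" by (simp add: transpose_def vec_eq_iff)
  then have "transpose (- S) = - (- S)" by (simp only: S)
  then obtain V where V: "\<And>t. orthogonal_matrix (V t)"
      "((\<lambda>t. (1 / t) *\<^sub>R (V t - mat 1)) \<longlongrightarrow> - S) (at_right 0)"
    using orthogonal_curve by blast
  define E where "E t = (1 / t) *\<^sub>R (V t - mat 1)" for t
  have "invertible P0" using pos_def_det_pos[OF P0] by (simp add: invertible_det_nz)
  then obtain J where J: "P0 ** J = mat 1" "J ** P0 = mat 1" unfolding invertible_def by blast
  \<comment> \<open>The relevant trace is that of the inverse of \<open>P0\<close> times
    \<open>M\<close>. It equals \<open>trace B\<close>, as the trace is invariant under conjugation
    and vanishes on the skew matrix \<open>S\<close>.\<close>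
  have "\<forall>\<^sub>F t in at_right 0. det P0 < det (P0 + t *\<^sub>R M)"
  proof (rule det_perturb_gt[OF pos_def_det_pos[OF P0]])
    show "P0 ** (J ** B ** P0 - S) = M"
      by (simp add: M_def matrix_diff_ldistrib matrix_mul_assoc J)
    have "trace (transpose S) = trace S" by (simp add: trace_def transpose_def)
    then have "trace S = 0" unfolding S by (simp add: trace_def sum_negf)
    moreover have "trace (J ** B ** P0) = trace B"
      using trace_mul_sym[of "J ** B" P0] by (simp add: matrix_mul_assoc J)
    ultimately show "0 < trace (J ** B ** P0 - S)"
      using B by (simp add: trace_sub)
  qed
  moreover note pos_def_perturb[OF P0 symM]
  moreover note eventually_at_right_less[of "0 :: real"]
  ultimately have ev: "\<forall>\<^sub>F t in at_right 0. 0 < t \<and> (\<exists>P z x y. pos_def P \<and> det P0 \<le> det P \<and>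
      affine_img (P ** V t) z L \<subseteq> K \<and> x \<in> L \<and> y \<in> polar K \<and>
      1 < (P0 *v x + z0 + t *\<^sub>R (M *v x + B *v z0 + b - P *v (E t *v x))) \<bullet> y \<and>
      0 < (M *v x + B *v z0 + b - P *v (E t *v x)) \<bullet> y)"
  proof eventually_elim
    case (elim t)
    obtain P z where P: "john_max K ((*v) (V t) ` L) P z" "det P0 \<le> det P"
      using saddle[OF V(1)] by blast
    have pP: "pos_def P" and fit: "affine_img (P ** V t) z L \<subseteq> K"
      using P(1) by (auto simp: john_max_def affine_img_def matrix_vector_mul_assoc image_image)
    define P' where "P' = (1/2) *\<^sub>R (P + (P0 + t *\<^sub>R M))"
    define w where "w = (1/2) *\<^sub>R (z + (z0 + t *\<^sub>R (B *v z0 + b)))"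
    have "pos_def P'"
      using pos_def_convex[OF pP elim(2), of "1/2" "1/2"] by (simp add: P'_def scaleR_add_right)
    moreover have "det P0 < det P'"
    proof (cases "P = P0 + t *\<^sub>R M")
      case True
      then have "P' = P0 + t *\<^sub>R M" by (simp only: P'_def scaleR_half_double)
      with elim show ?thesis by simp
    next
      case False
      then show ?thesis
        unfolding P'_def using pP elim P(2) pos_def_det_pos[OF P0]
        by (intro det_midpoint_gt) auto
    qed
    ultimately obtain x where x: "x \<in> L" "P' *v x + w \<notin> K" using max0 by blast
    obtain y where y: "y \<in> polar K" "1 < (P' *v x + w) \<bullet> y"
      using polar_separation[of K "P' *v x + w"] x(2) K interior_subset[of K]
      by (auto simp: convex_body_def compact_imp_closed)
    define h where "h = M *v x + B *v z0 + b - P *v (E t *v x)"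
    have "(P ** V t) *v x = P *v x + t *\<^sub>R (P *v (E t *v x))"
    proof -
      have "V t = mat 1 + t *\<^sub>R E t" using elim by (simp add: E_def)
      then have "V t *v x = x + t *\<^sub>R (E t *v x)"
        by (metis matrix_vector_mult_add_rdistrib matrix_vector_mul_lid scaleR_matrix_vector_assoc)
      then show ?thesis
        by (simp add: matrix_vector_mul_assoc [symmetric] matrix_vector_right_distrib matrix_vector_mult_scaleR)
    qed
    \<comment> \<open>The point outside \<open>K\<close> is the midpoint of a point of
      \<open>K\<close> and of \<open>P0 *v x + z0\<close> moved by \<open>t *\<^sub>R h\<close>.
      Hence \<open>y\<close> exceeds 1 at the moved point but not before the move, which gives
      \<open>0 < h \<bullet> y\<close>.\<close>
    then have "P' *v x + w = (1/2) *\<^sub>R (((P ** V t) *v x + z) + (P0 *v x + z0 + t *\<^sub>R h))"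
      by (simp add: P'_def w_def h_def scaleR_matrix_vector_assoc [symmetric]
          matrix_vector_mult_add_rdistrib scaleR_add_right scaleR_diff_right)
    then have "(P' *v x + w) \<bullet> y = (1/2) * (((P ** V t) *v x + z) \<bullet> y + (P0 *v x + z0 + t *\<^sub>R h) \<bullet> y)"
      by (simp only: inner_scaleR_left inner_add_left)
    moreover have "((P ** V t) *v x + z) \<bullet> y \<le> 1"
      using fit x(1) y(1) by (auto simp: affine_img_def polar_def)
    moreover have "s = (1/2) * (\<alpha> + \<gamma>) \<Longrightarrow> \<alpha> \<le> 1 \<Longrightarrow> 1 < s \<Longrightarrow> 1 < \<gamma>" for s \<alpha> \<gamma> :: real
      by simp
    ultimately have gt: "1 < (P0 *v x + z0 + t *\<^sub>R h) \<bullet> y" using y(2) by blast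
    moreover have "(P0 *v x + z0) \<bullet> y \<le> 1" using fit0[OF x(1)] y(1) by (simp add: polar_def)
    ultimately have "0 < t * (h \<bullet> y)" unfolding inner_add_left[of "P0 *v x + z0"] by simp
    then have "0 < h \<bullet> y" using elim by (simp add: zero_less_mult_iff)
    with gt show ?case
      unfolding h_def using elim pP P(2) fit x(1) y(1) by blast
  qed
  have seq: "filterlim (\<lambda>k. inverse (real (Suc k))) (at_right 0) sequentially"
    unfolding filterlim_at using LIMSEQ_inverse_real_of_nat by (auto simp del: of_nat_Suc)
  obtain N where N: "\<And>k. k \<ge> N \<Longrightarrow> (\<exists>P z x y. pos_def P \<and> det P0 \<le> det P \<and>
      affine_img (P ** V (inverse (real (Suc k)))) z L \<subseteq> K \<and> x \<in> L \<and> y \<in> polar K \<and>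
      1 < (P0 *v x + z0 + inverse (real (Suc k)) *\<^sub>R (M *v x + B *v z0 + b - P *v (E (inverse (real (Suc k))) *v x))) \<bullet> y \<and>
      0 < (M *v x + B *v z0 + b - P *v (E (inverse (real (Suc k))) *v x)) \<bullet> y)"
    using eventually_compose_filterlim[OF ev seq] unfolding eventually_sequentially by blast
  \<comment> \<open>Shifting by \<open>N\<close> makes the eventual statement hold at every
    index.\<close>
  define \<tau> where "\<tau> k = inverse (real (Suc (k + N)))" for k
  have \<tau>: "filterlim \<tau> (at_right 0) sequentially"
    unfolding \<tau>_def by (rule filterlim_compose[OF seq filterlim_add_const_nat_at_top])
  have "\<forall>k. \<exists>P z x y. pos_def P \<and> det P0 \<le> det P \<and>
      affine_img (P ** V (\<tau> k)) z L \<subseteq> K \<and> x \<in> L \<and> y \<in> polar K \<and>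
      1 < (P0 *v x + z0 + \<tau> k *\<^sub>R (M *v x + B *v z0 + b - P *v (E (\<tau> k) *v x))) \<bullet> y \<and>
      0 < (M *v x + B *v z0 + b - P *v (E (\<tau> k) *v x)) \<bullet> y"
    unfolding \<tau>_def by (intro allI N) simp
  then obtain P z x y where P: "\<And>k. pos_def (P k)" "\<And>k. det P0 \<le> det (P k)"
      and fit: "\<And>k. affine_img (P k ** V (\<tau> k)) (z k) L \<subseteq> K"
      and x: "\<And>k. x k \<in> L" and y: "\<And>k. y k \<in> polar K"
      and touch: "\<And>k. 1 < (P0 *v x k + z0 + \<tau> k *\<^sub>R (M *v x k + B *v z0 + b - P k *v (E (\<tau> k) *v x k))) \<bullet> y k"
      and push: "\<And>k. 0 < (M *v x k + B *v z0 + b - P k *v (E (\<tau> k) *v x k)) \<bullet> y k"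
    by metis
  \<comment> \<open>Compactness applies to the products \<open>P k ** V (\<tau> k)\<close>, which
    fit \<open>L\<close> itself into \<open>K\<close>; \<open>P k\<close> is recovered by
    multiplying with the transpose of \<open>V (\<tau> k)\<close>, which tends to the
    identity.\<close>
  define G where "G = {p. affine_img (fst p) (snd p) L \<subseteq> K}"
  have "compact (G \<times> (L \<times> polar K))"
    unfolding G_def using K L
    by (intro compact_Times compact_affine_fits compact_polar) (auto simp: convex_body_def)
  moreover have "((P k ** V (\<tau> k), z k), (x k, y k)) \<in> G \<times> (L \<times> polar K)" for k
    using fit x y by (simp add: G_def)
  ultimately obtain l r where l: "l \<in> G \<times> (L \<times> polar K)" and r: "strict_mono r"
      and lim: "((\<lambda>k. ((P k ** V (\<tau> k), z k), (x k, y k))) \<circ> r) \<longlonglongrightarrow> l"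
    unfolding compact_def by (metis (no_types, lifting))
  obtain Q w x' y' where lq: "l = ((Q, w), (x', y'))" by (metis surj_pair)
  have Qfit: "affine_img Q w L \<subseteq> K" and x': "x' \<in> L" and y': "y' \<in> polar K"
    using l by (auto simp: lq G_def)
  define \<sigma> where "\<sigma> = \<tau> \<circ> r"
  have \<sigma>: "filterlim \<sigma> (at_right 0) sequentially"
    unfolding \<sigma>_def o_def using filterlim_compose[OF \<tau> filterlim_subseq[OF r]] .
  have \<sigma>0: "\<sigma> \<longlonglongrightarrow> 0" using \<sigma> by (simp add: filterlim_at)
  have lim: "(\<lambda>k. P (r k) ** V (\<sigma> k)) \<longlonglongrightarrow> Q" "(\<lambda>k. x (r k)) \<longlonglongrightarrow> x'" "(\<lambda>k. y (r k)) \<longlonglongrightarrow> y'"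
    using tendsto_fst[OF tendsto_fst[OF lim]] tendsto_fst[OF tendsto_snd[OF lim]] tendsto_snd[OF tendsto_snd[OF lim]]
    by (simp_all add: lq \<sigma>_def o_def)
  have limE: "(\<lambda>k. E (\<sigma> k)) \<longlonglongrightarrow> - S"
    using filterlim_compose[OF V(2) \<sigma>] by (simp add: E_def)
  have V_eq: "V (\<sigma> k) = mat 1 + \<sigma> k *\<^sub>R E (\<sigma> k)" for k
    by (simp add: E_def \<sigma>_def \<tau>_def)
  have "(\<lambda>k. mat 1 + \<sigma> k *\<^sub>R E (\<sigma> k)) \<longlonglongrightarrow> mat 1 + 0 *\<^sub>R (- S)"
    by (intro tendsto_intros \<sigma>0 limE)
  then have limV: "(\<lambda>k. V (\<sigma> k)) \<longlonglongrightarrow> mat 1" by (simp add: V_eq)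
  have "(\<lambda>k. (P (r k) ** V (\<sigma> k)) ** transpose (V (\<sigma> k))) \<longlonglongrightarrow> Q ** transpose (mat 1)"
    by (intro tendsto_intros lim limV)
  moreover have "(P (r k) ** V (\<sigma> k)) ** transpose (V (\<sigma> k)) = P (r k)" for k
    using V(1) by (simp add: matrix_mul_assoc [symmetric] orthogonal_matrix_def)
  ultimately have limP: "(\<lambda>k. P (r k)) \<longlonglongrightarrow> Q" by simp
  have detQ: "det P0 \<le> det Q"
    by (rule tendsto_lowerbound[OF tendsto_det[OF limP]]) (use P(2) in auto)
  have "pos_def Q"
  proof (rule pos_defI)
    have "(\<lambda>k. transpose (P (r k))) \<longlonglongrightarrow> transpose Q" by (intro tendsto_intros limP)
    then have "(\<lambda>k. P (r k)) \<longlonglongrightarrow> transpose Q" using P(1) by (simp add: pos_def_def)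
    then show "transpose Q = Q" using limP by (rule LIMSEQ_unique)
    show "0 \<le> v \<bullet> (Q *v v)" for v
    proof (rule tendsto_lowerbound)
      show "(\<lambda>k. v \<bullet> (P (r k) *v v)) \<longlonglongrightarrow> v \<bullet> (Q *v v)" by (intro tendsto_intros limP)
      have "0 \<le> v \<bullet> (P (r k) *v v)" for k
        using P(1) by (cases "v = 0") (auto simp: pos_def_def less_imp_le)
      then show "\<forall>\<^sub>F k in sequentially. 0 \<le> v \<bullet> (P (r k) *v v)" by simp
    qed simp
    show "det Q \<noteq> 0" using detQ pos_def_det_pos[OF P0] by simp
  qed
  \<comment> \<open>The limit pair fits and its determinant is at least the maximal one, so
    uniqueness applies.\<close>
  then have Q: "Q = P0"
    using john_max_unique[OF K(1) L max _ Qfit detQ] by simp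
  let ?h = "\<lambda>k. M *v x (r k) + B *v z0 + b - P (r k) *v (E (\<sigma> k) *v x (r k))"
  let ?h' = "M *v x' + B *v z0 + b - P0 *v (- S *v x')"
  have limh: "?h \<longlonglongrightarrow> ?h'"
    by (intro tendsto_intros lim limE limP [unfolded Q])
  \<comment> \<open>The rotation contributes \<open>P0 ** S\<close> in the limit, which restores
    \<open>M + P0 ** S = B ** P0\<close>.\<close>
  have h': "?h' = B *v (P0 *v x' + z0) + b"
  proof -
    have "- S *v x' = - (S *v x')"
      by (simp add: matrix_vector_mult_def vec_eq_iff sum_negf)
    then have "P0 *v (- S *v x') = - (P0 *v (S *v x'))"
      using matrix_vector_mult_diff_distrib[of P0 0 "S *v x'"] by simp
    then show ?thesis
      by (simp add: M_def matrix_vector_mult_diff_rdistrib matrix_vector_mul_assoc [symmetric] algebra_simps)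
  qed
  have "0 \<le> ?h' \<bullet> y'"
  proof (rule tendsto_lowerbound)
    show "(\<lambda>k. ?h k \<bullet> y (r k)) \<longlonglongrightarrow> ?h' \<bullet> y'" by (intro tendsto_intros limh lim)
    show "\<forall>\<^sub>F k in sequentially. 0 \<le> ?h k \<bullet> y (r k)"
      using push by (simp add: \<sigma>_def less_imp_le)
  qed simp
  moreover have "1 \<le> (P0 *v x' + z0) \<bullet> y'"
  proof (rule tendsto_lowerbound)
    have "(\<lambda>k. (P0 *v x (r k) + z0 + \<sigma> k *\<^sub>R ?h k) \<bullet> y (r k)) \<longlonglongrightarrow> (P0 *v x' + z0 + 0 *\<^sub>R ?h') \<bullet> y'"
      by (intro tendsto_intros limh lim \<sigma>0)
    then show "(\<lambda>k. (P0 *v x (r k) + z0 + \<sigma> k *\<^sub>R ?h k) \<bullet> y (r k)) \<longlonglongrightarrow> (P0 *v x' + z0) \<bullet> y'"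
      by simp
    show "\<forall>\<^sub>F k in sequentially. 1 \<le> (P0 *v x (r k) + z0 + \<sigma> k *\<^sub>R ?h k) \<bullet> y (r k)"
      using touch by (simp add: \<sigma>_def less_imp_le)
  qed simp
  moreover have "(P0 *v x' + z0) \<bullet> y' \<le> 1" using fit0[OF x'] y' by (simp add: polar_def)
  moreover have "P0 *v x' + z0 \<in> affine_img P0 z0 L" using x' by (simp add: affine_img_def)
  ultimately show ?thesis using y' unfolding h' by force
qed

section \<open>Decomposition of the identity by convex separation\<close>

lemma inner_outer_prod:
  "C \<bullet> (x \<otimes>\<^sub>o y) = x \<bullet> (C *v y)"
  by (simp add: outer_prod_def inner_vec_def matrix_vector_mult_def sum_distrib_left mult_ac)

lemma inner_mat_1: "C \<bullet> mat 1 = trace (C :: real^'n^'n)"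
  by (simp add: inner_vec_def mat_def trace_def if_distrib cong: if_cong)

theorem theorem1p3:
  fixes K L :: "(real ^ 'n) set"
  assumes "convex_body K" and "0 \<in> interior K"
    and "convex_body L"
    and "saddle_john_position K L"
  shows "\<exists>(m::nat) (x :: nat \<Rightarrow> real ^ 'n) (y :: nat \<Rightarrow> real ^ 'n) (c :: nat \<Rightarrow> real).
           (\<forall>i\<in>{1..m}. contact_pair K L (x i) (y i) \<and> c i > 0) \<and>
           (\<Sum>i=1..m. c i *\<^sub>R y i) = 0 \<and>
           (\<Sum>i=1..m. c i *\<^sub>R (x i \<otimes>\<^sub>o y i)) = mat 1"
proof -
  obtain U where U: "orthogonal_matrix U"
      and Umin: "\<And>V. orthogonal_matrix V \<Longrightarrow> det (Pstar K L U) \<le> det (Pstar K L V)"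
      and L: "L = affine_img (Pstar K L U) (zstar K L U) ((*v) U ` L)"
    using assms(4) unfolding saddle_john_position_def saddle_john_image_def is_arg_min_def
    by (metis not_less)
  define P0 z0 L0 where "P0 = Pstar K L U" and "z0 = zstar K L U" and "L0 = (*v) U ` L"
  have L_eq: "L = affine_img P0 z0 L0" using L by (simp only: P0_def z0_def L0_def)
  have L0: "convex_body L0"
    unfolding L0_def using U assms(3)
    by (intro convex_body_linear_image) (auto simp: orthogonal_matrix_def invertible_def)
  have max: "john_max K L0 P0 z0"
    unfolding P0_def z0_def L0_def by (rule john_max_Pstar[OF assms(1,3) U])
  have saddle: "\<exists>P z. john_max K ((*v) V ` L0) P z \<and> det P0 \<le> det P" if V: "orthogonal_matrix V" for V
  proof -
    have VU: "orthogonal_matrix (V ** U)" using V U by (rule orthogonal_matrix_mul)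
    have "(*v) V ` L0 = (*v) (V ** U) ` L"
      by (simp add: L0_def image_image matrix_vector_mul_assoc)
    then show ?thesis
      using john_max_Pstar[OF assms(1,3) VU] Umin[OF VU] by (auto simp: P0_def)
  qed
  have LK: "L \<subseteq> K" using max L_eq by (simp add: john_max_def)
  \<comment> \<open>By \<open>contact_pairI\<close> all elements of \<open>C\<close> are contact
    pairs. The map \<open>\<Phi>\<close> records matrix and vector together, so both required
    identities become one convex combination.\<close>
  define C where "C = {p \<in> L \<times> polar K. fst p \<bullet> snd p = 1}"
  define \<Phi> where "\<Phi> p = (fst p \<otimes>\<^sub>o snd p, snd p)" for p :: "(real^'n) \<times> (real^'n)"
  have "compact C"
  proof -
    have "C = (L \<times> polar K) \<inter> {p. fst p \<bullet> snd p = 1}" by (auto simp: C_def)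
    moreover have "closed {p :: (real^'n) \<times> (real^'n). fst p \<bullet> snd p = 1}"
      by (intro closed_Collect_eq continuous_intros)
    ultimately show ?thesis
      using assms(3) compact_polar[OF assms(2)]
      by (auto intro!: compact_Int_closed compact_Times simp: convex_body_def)
  qed
  moreover have "continuous_on C \<Phi>"
    unfolding \<Phi>_def outer_prod_def by (intro continuous_intros)
  ultimately have cpt: "compact (convex hull (\<Phi> ` C))"
    by (intro compact_convex_hull compact_continuous_image)
  define n where "n = real CARD('n)"
  have n: "0 < n" by (simp add: n_def)
  \<comment> \<open>Each \<open>x \<otimes>\<^sub>o y\<close> from \<open>C\<close> has trace 1,
    hence the normalization of the identity to trace 1.\<close>
  have "((1 / n) *\<^sub>R mat 1, 0) \<in> convex hull (\<Phi> ` C)"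
  proof (rule ccontr)
    assume "\<not> ?thesis"
    then obtain p \<beta> where sep: "p \<bullet> ((1 / n) *\<^sub>R mat 1, 0) < \<beta>"
        "\<And>q. q \<in> convex hull (\<Phi> ` C) \<Longrightarrow> \<beta> < p \<bullet> q"
      using separating_hyperplane_closed_point[OF convex_convex_hull compact_imp_closed[OF cpt]] by blast
    obtain D d where p: "p = (D, d)" by (cases p)
    text \<open>Since \<open>x \<otimes>\<^sub>o y\<close> has trace \<open>1\<close> on \<open>C\<close>, the constant \<open>\<beta>\<close> can be absorbed into the matrix.\<close>
    define B where "B = \<beta> *\<^sub>R mat 1 - transpose D"
    have "trace D < \<beta> * n"
      using sep(1) n by (simp add: p inner_mat_1 field_simps)
    then have "0 < trace B"
      by (simp add: B_def trace_sub trace_def transpose_def mat_def n_def sum_subtractf mult.commute)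
    then obtain x y where xy: "x \<in> L" "y \<in> polar K" "x \<bullet> y = 1" "0 \<le> (B *v x + (- d)) \<bullet> y"
      using saddle_first_order[OF assms(1,2) L0 max saddle, of B "- d"] unfolding L_eq [symmetric] by blast
    have "(x, y) \<in> C" using xy by (simp add: C_def)
    then have "\<Phi> (x, y) \<in> convex hull (\<Phi> ` C)" by (intro hull_inc imageI)
    from sep(2)[OF this] have "\<beta> < x \<bullet> (D *v y) + d \<bullet> y"
      by (simp add: p \<Phi>_def inner_outer_prod)
    moreover have "(B *v x) \<bullet> y = \<beta> - x \<bullet> (D *v y)"
      using xy(3) by (simp add: B_def matrix_vector_mult_diff_rdistrib scaleR_matrix_vector_assoc [symmetric]
          inner_diff_left dot_lmul_matrix)
    ultimately show False using xy(4) by (simp add: inner_diff_left)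
  qed
  then obtain T u where T: "finite T" "T \<subseteq> \<Phi> ` C" "\<And>q. q \<in> T \<Longrightarrow> 0 \<le> u q"
      and sum: "(\<Sum>q\<in>T. u q *\<^sub>R q) = ((1 / n) *\<^sub>R mat 1, 0)"
    unfolding convex_hull_explicit by blast
  \<comment> \<open>Terms of weight 0 are dropped because the coefficients must be strictly
    positive.\<close>
  define T' where "T' = {q \<in> T. u q \<noteq> 0}"
  have T': "finite T'" "T' \<subseteq> \<Phi> ` C" "\<And>q. q \<in> T' \<Longrightarrow> 0 < u q"
    using T by (auto simp: T'_def less_le)
  have sum': "(\<Sum>q\<in>T'. u q *\<^sub>R q) = ((1 / n) *\<^sub>R mat 1, 0)"
    unfolding sum [symmetric] T'_def using T(1) by (intro sum.mono_neutral_left) auto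
  obtain f where f: "bij_betw f {1..card T'} T'"
    using ex_bij_betw_nat_finite_1[OF T'(1)] by blast
  have "\<forall>q\<in>T'. \<exists>p. p \<in> C \<and> \<Phi> p = q" using T'(2) by blast
  then obtain g where g: "\<And>q. q \<in> T' \<Longrightarrow> g q \<in> C \<and> \<Phi> (g q) = q" by metis
  \<comment> \<open>The factor \<open>n\<close> undoes the trace normalization.\<close>
  define x y c where "x i = fst (g (f i))" and "y i = snd (g (f i))" and "c i = n * u (f i)" for i
  have fT: "f i \<in> T'" if "i \<in> {1..card T'}" for i using f that by (auto simp: bij_betw_def)
  have pair: "(x i \<otimes>\<^sub>o y i, y i) = f i" if "i \<in> {1..card T'}" for i
    using g[OF fT[OF that]] by (simp add: \<Phi>_def x_def y_def)
  have "(\<Sum>i=1..card T'. c i *\<^sub>R (x i \<otimes>\<^sub>o y i, y i)) = (\<Sum>i=1..card T'. n *\<^sub>R (u (f i) *\<^sub>R f i))"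
    by (intro sum.cong refl) (simp only: pair c_def scaleR_scaleR)
  also have "\<dots> = n *\<^sub>R (\<Sum>q\<in>T'. u q *\<^sub>R q)"
    unfolding scaleR_sum_right [symmetric] by (subst sum.reindex_bij_betw[OF f]) simp
  also have "\<dots> = (mat 1, 0)"
    using n by (simp add: sum')
  finally have total: "(\<Sum>i=1..card T'. c i *\<^sub>R (x i \<otimes>\<^sub>o y i, y i)) = (mat 1, 0)" .
  have "\<forall>i\<in>{1..card T'}. contact_pair K L (x i) (y i) \<and> c i > 0"
  proof
    fix i assume i: "i \<in> {1..card T'}"
    have "g (f i) \<in> C" using g fT[OF i] by blast
    then have "contact_pair K L (x i) (y i)"
      by (intro contact_pairI LK) (auto simp: C_def x_def y_def)
    then show "contact_pair K L (x i) (y i) \<and> c i > 0"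
      using T'(3)[OF fT[OF i]] n by (simp add: c_def)
  qed
  moreover have "(\<Sum>i=1..card T'. c i *\<^sub>R y i) = 0"
    using arg_cong[OF total, of snd] by (simp add: snd_sum)
  moreover have "(\<Sum>i=1..card T'. c i *\<^sub>R (x i \<otimes>\<^sub>o y i)) = mat 1"
    using arg_cong[OF total, of fst] by (simp add: fst_sum)
  ultimately show ?thesis by blast
qed

end
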